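(* Let $T<\min(T^*,t_* )$. Let $(L_t)$ be the loss function of the McKean--Vlasov system and, for $n\ge1$ and $h=T/n$, let $(\breve L_t)_{t\in[0,T]}$ be the loss function of the continuously monitored scheme on the uniform mesh $t_i=ih$, all as defined in the context, with $\beta\in(0,1]$ the exponent in the assumption on the density of $Y_0$. Then there exists $C>0$ independent of $h$ such that $$\max_{i\le n}\,|\breve L_{t_i}-L_{t_i}|\le C\,h^{\frac{1+\beta}{2}}.$$
   Context: Setting: $\alpha,T\in\mathbb{R}_+$ (positive); $W$ is a standard Brownian motion on a filtered probability space $(\Omega,\mathcal F,(\mathcal F_t)_{t\ge0},\mathbb P)$, and $Y_0$ is an $\mathbb{R}_+$-valued random variable independent of $W$. McKean--Vlasov system: $Y_t=Y_0+W_t-\alpha L_t$, $L_t=\mathbb P(\tau\le t)$, $\tau=\inf\{t: Y_t\le 0\}$ ($t\in[0,T]$). Assumption on $Y_0$: $Y_0$ has a density $f_{Y_0}$ supported on $\mathbb R_+$ with $f_{Y_0}(x)\le B x^{\beta}$ for all $x\ge0$, for some $\beta\in(0,1]$ and a constant $B$. Known fact (existence and regularity, taken as background): under this assumption there is a unique differentiable solution $t\mapsto L_t$ of the system up to the explosion time $t_*:=\sup\{t>0:\|L\|_{H^1(0,t)}<\infty\}\in[0,\infty]$, and there is a constant $\hat B$ with $L_t'\le\hat B\,t^{-\frac{1-\beta}{2}}$ for a.e. $t<t_*$. Consequently $L_t\le\tilde B\,t^{\frac{1+\beta}{2}}$ for $t<t_*$ for some constant $\tilde B$ (e.g. $\tilde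 B=2\hat B/(1+\beta)$). $L$ denotes this solution and $Y$ the corresponding process. Definition of $T^*$: $T^*$ is defined by $$\alpha B\left[\sqrt{\tfrac{2T^*}{\pi}}+\alpha\tilde B\,(T^* )^{\frac{1+\beta}{2}}\right]^{\beta}=1,$$ with $B$ and $\tilde B$ the smallest constants such that $f_{Y_0}(x)\le Bx^\beta$ for all $x\ge 0$ and $L_t\le\tilde B t^{\frac{1+\beta}{2}}$ for all $t<t_*$ hold for the given $\beta$. Continuously monitored (Brownian bridge) scheme on the mesh $0=t_0<t_1<\dots<t_n=T$, $t_i-t_{i-1}=h$: $$\breve Y_t=Y_0+W_t-\alpha\breve L_t,\qquad \breve L_t=\mathbb P(\breve\tau<t_i)\quad\text{for }t\in[t_i,t_{i+1}),\qquad \breve\tau=\inf\{s\in[0,T]:\breve Y_s\le0\},$$ (with $\inf\emptyset=\infty$), and $\breve L_{t_n}=\mathbb P(\breve\tau<t_n)$. The construction is explicit: $\breve L$ is piecewise constant and its value on $[t_i,t_{i+1})$ depends only on $\breve Y$ on $[0,t_i)$. *)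

theory Defs
  imports "HOL-Probability.Probability"
begin

section \<open>Brownian motion on a filtered probability space\<close>

text \<open>The filtration is indexed by the half-line; values of \<open>F\<close> at negative times are irrelevant.\<close>

definition filtered_prob_space :: "'a measure \<Rightarrow> (real \<Rightarrow> 'a measure) \<Rightarrow> bool" where
  "filtered_prob_space M F \<longleftrightarrow>
     prob_space M \<and>
     (\<forall>t\<ge>0. subalgebra M (F t)) \<and>
     (\<forall>s t. 0 \<le> s \<and> s \<le> t \<longrightarrow> sets (F s) \<subseteq> sets (F t))"

definition standard_brownian_motion ::
    "'a measure \<Rightarrow> (real \<Rightarrow> 'a measure) \<Rightarrow> (real \<Rightarrow> 'a \<Rightarrow> real) \<Rightarrow> bool" where
  "standard_brownian_motion M F W \<longleftrightarrow>
     (\<forall>t\<ge>0. W t \<in> borel_measurable (F t)) \<and>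
     (AE \<omega> in M. W 0 \<omega> = 0) \<and>
     (\<forall>\<omega>\<in>space M. continuous_on {0..} (\<lambda>t. W t \<omega>)) \<and>
     (\<forall>s t. 0 \<le> s \<and> s < t \<longrightarrow>
        distributed M lborel (\<lambda>\<omega>. W t \<omega> - W s \<omega>) (normal_density 0 (sqrt (t - s))) \<and>
        prob_space.indep_set M (sets (F s))
          {(\<lambda>\<omega>. W t \<omega> - W s \<omega>) -` A \<inter> space M | A. A \<in> sets borel})"

text \<open>Independence of \<open>X\<close> and the sigma-algebra generated by \<open>W t\<close>, \<open>t \<ge> 0\<close>.\<close>

definition indep_of_process ::
    "'a measure \<Rightarrow> ('a \<Rightarrow> real) \<Rightarrow> (real \<Rightarrow> 'a \<Rightarrow> real) \<Rightarrow> bool" where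
  "indep_of_process M X W \<longleftrightarrow>
     prob_space.indep_set M
       {X -` A \<inter> space M | A. A \<in> sets borel}
       {(\<lambda>\<omega>. \<lambda>t\<in>{0..}. W t \<omega>) -` A \<inter> space M | A. A \<in> sets (Pi\<^sub>M {0..} (\<lambda>_. borel))}"

section \<open>The Sobolev space of order one on an interval\<close>

text \<open>
  Weak derivative on an open set \<open>I\<close>, tested against continuously differentiable functions
  with compact support in \<open>I\<close> (as in Brezis' book; in one dimension these and the smooth test
  functions give the same weak derivatives).  Local integrability is required explicitly
  because the integral of a non-integrable function is 0 by convention.
\<close>

definition weak_derivative :: "real set \<Rightarrow> (real \<Rightarrow> real) \<Rightarrow> (real \<Rightarrow> real) \<Rightarrow> bool" where
  "weak_derivative I u v \<longleftrightarrow>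
     (\<forall>K. compact K \<and> K \<subseteq> I \<longrightarrow> set_integrable lborel K u \<and> set_integrable lborel K v) \<and>
     (\<forall>\<phi> \<phi>' K. (\<forall>x. (\<phi> has_real_derivative \<phi>' x) (at x)) \<and> continuous_on UNIV \<phi>' \<and>
         compact K \<and> K \<subseteq> I \<and> (\<forall>x. x \<notin> K \<longrightarrow> \<phi> x = 0) \<longrightarrow>
         (LINT x:I|lborel. u x * \<phi>' x) = - (LINT x:I|lborel. v x * \<phi> x))"

text \<open>
  The weak derivative is unique almost everywhere, so the infimum below is over a set with at
  most one element; it is \<open>\<infinity>\<close> exactly if the function is not in the Sobolev space.
\<close>

definition H1_norm :: "real set \<Rightarrow> (real \<Rightarrow> real) \<Rightarrow> ereal" where
  "H1_norm I u =
     (INF v \<in> {v. weak_derivative I u v \<and>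
                  set_integrable lborel I (\<lambda>x. (u x)\<^sup>2) \<and> set_integrable lborel I (\<lambda>x. (v x)\<^sup>2)}.
        ereal (sqrt ((LINT x:I|lborel. (u x)\<^sup>2) + (LINT x:I|lborel. (v x)\<^sup>2))))"

text \<open>Inserting 0 only serves to make the supremum over the empty set equal to 0.\<close>

definition explosion_time :: "(real \<Rightarrow> real) \<Rightarrow> ereal" where
  "explosion_time L = Sup (insert 0 {ereal t | t. 0 < t \<and> H1_norm {0<..<t} L < \<infinity>})"

section \<open>The McKean--Vlasov system\<close>

definition hitting_time :: "real set \<Rightarrow> (real \<Rightarrow> real) \<Rightarrow> ereal" where
  "hitting_time J y = Inf (ereal ` {t \<in> J. y t \<le> 0})"

definition mv_path ::
    "real \<Rightarrow> ('a \<Rightarrow> real) \<Rightarrow> (real \<Rightarrow> 'a \<Rightarrow> real) \<Rightarrow> (real \<Rightarrow> real) \<Rightarrow> 'a \<Rightarrow> real \<Rightarrow> real" where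
  "mv_path \<alpha> Y0 W L \<omega> t = Y0 \<omega> + W t \<omega> - \<alpha> * L t"

text \<open>
  A solution on the time interval \<open>J\<close> (containing 0).  For \<open>t \<in> J\<close> the set where the hitting
  time is at most \<open>t\<close> must be an event, as the measure of a non-measurable set is 0 by convention.
\<close>

definition mckean_vlasov_solution ::
    "'a measure \<Rightarrow> real \<Rightarrow> ('a \<Rightarrow> real) \<Rightarrow> (real \<Rightarrow> 'a \<Rightarrow> real) \<Rightarrow> real set \<Rightarrow> (real \<Rightarrow> real) \<Rightarrow> bool"
  where
  "mckean_vlasov_solution M \<alpha> Y0 W J L \<longleftrightarrow>
     (\<forall>t\<in>J. {\<omega> \<in> space M. hitting_time J (mv_path \<alpha> Y0 W L \<omega>) \<le> ereal t} \<in> sets M \<and>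
            L t = measure M {\<omega> \<in> space M. hitting_time J (mv_path \<alpha> Y0 W L \<omega>) \<le> ereal t})"

section \<open>The continuously monitored scheme\<close>

definition mesh :: "real \<Rightarrow> nat \<Rightarrow> nat \<Rightarrow> real" where
  "mesh T n i = real i * (T / real n)"

definition bridge_scheme ::
    "'a measure \<Rightarrow> real \<Rightarrow> ('a \<Rightarrow> real) \<Rightarrow> (real \<Rightarrow> 'a \<Rightarrow> real) \<Rightarrow> real \<Rightarrow> nat \<Rightarrow> (real \<Rightarrow> real) \<Rightarrow> bool"
  where
  "bridge_scheme M \<alpha> Y0 W T n Lb \<longleftrightarrow>
     (\<forall>i<n. \<forall>t\<in>{mesh T n i..<mesh T n (Suc i)}.
        Lb t = measure M {\<omega> \<in> space M.
                 hitting_time {0..T} (mv_path \<alpha> Y0 W Lb \<omega>) < ereal (mesh T n i)}) \<and>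
     Lb (mesh T n n) = measure M {\<omega> \<in> space M.
                 hitting_time {0..T} (mv_path \<alpha> Y0 W Lb \<omega>) < ereal (mesh T n n)}"

text \<open>
  The right-hand side of the scheme at \<open>t\<^sub>i\<close> only involves the path strictly before \<open>t\<^sub>i\<close>.
  Hence the scheme has a solution, and it is unique on \<open>[0,T]\<close>.
\<close>

lemma hitting_time_less_iff:
  "hitting_time J y < ereal c \<longleftrightarrow> (\<exists>s\<in>J. s < c \<and> y s \<le> 0)"
  by (auto simp: hitting_time_def Inf_less_iff)

lemma hitting_event_cong:
  assumes "\<And>t. 0 \<le> t \<Longrightarrow> t < c \<Longrightarrow> l t = l' t"
  shows "(hitting_time {0..T} (mv_path \<alpha> Y0 W l \<omega>) < ereal c) =
         (hitting_time {0..T} (mv_path \<alpha> Y0 W l' \<omega>) < ereal c)"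
  using assms by (force simp: hitting_time_less_iff mv_path_def)

lemma mesh_mono: "T > 0 \<Longrightarrow> i \<le> j \<Longrightarrow> mesh T n i \<le> mesh T n j"
  unfolding mesh_def by (rule mult_right_mono) auto

lemma mesh_less: "T > 0 \<Longrightarrow> n > 0 \<Longrightarrow> i < j \<Longrightarrow> mesh T n i < mesh T n j"
  unfolding mesh_def by (rule mult_strict_right_mono) auto

lemma mesh_last: "n > 0 \<Longrightarrow> mesh T n n = T"
  by (simp add: mesh_def)

lemma bridge_scheme_exists:
  fixes M :: "'a measure" and Y0 :: "'a \<Rightarrow> real"
  assumes "T > 0" "n > 0"
  shows "\<exists>Lb. bridge_scheme M \<alpha> Y0 W T n Lb"
proof -
  define G where "G l i = measure M {\<omega> \<in> space M.
      hitting_time {0..T} (mv_path \<alpha> Y0 W l \<omega>) < ereal (mesh T n i)}" for l i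
  have cong: "G l i = G l' i" if "\<And>t. t < mesh T n i \<Longrightarrow> l t = l' t" for l l' i
    unfolding G_def using that by (simp add: hitting_event_cong[of "mesh T n i" l l'])
  have "\<exists>l. \<forall>i<k. \<forall>t\<in>{mesh T n i..<mesh T n (Suc i)}. l t = G l i" for k
  proof (induction k)
    case 0
    then show ?case by simp
  next
    case (Suc k)
    then obtain l where l: "\<And>i t. i < k \<Longrightarrow> t \<in> {mesh T n i..<mesh T n (Suc i)} \<Longrightarrow> l t = G l i"
      by blast
    define l' where "l' t = (if t < mesh T n k then l t else G l k)" for t
    have G: "G l' i = G l i" if "i \<le> k" for i
      using that mesh_mono[OF \<open>T > 0\<close>, of i k n] by (intro cong) (auto simp: l'_def)
    have "l' t = G l' i" if "i < Suc k" "t \<in> {mesh T n i..<mesh T n (Suc i)}" for i t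
    proof (cases "i = k")
      case True
      then show ?thesis using that G[of k] by (simp add: l'_def)
    next
      case False
      then have "i < k" using that by simp
      then have "t < mesh T n k" using that mesh_mono[OF \<open>T > 0\<close>, of "Suc i" k n] by simp
      then show ?thesis using l[OF \<open>i < k\<close> that(2)] G[of i] \<open>i < k\<close> by (simp add: l'_def)
    qed
    then show ?case by blast
  qed
  then obtain l where
    l: "\<And>i t. i < Suc n \<Longrightarrow> t \<in> {mesh T n i..<mesh T n (Suc i)} \<Longrightarrow> l t = G l i"
    by meson
  have "l (mesh T n n) = G l n"
    using l[of n "mesh T n n"] mesh_less[OF assms, of n "Suc n"] by simp
  then have "bridge_scheme M \<alpha> Y0 W T n l"
    using l unfolding bridge_scheme_def G_def by simp
  then show ?thesis by (intro exI)
qed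

lemma bridge_scheme_unique:
  fixes M :: "'a measure" and Y0 :: "'a \<Rightarrow> real"
  assumes "T > 0" "n > 0" "bridge_scheme M \<alpha> Y0 W T n l" "bridge_scheme M \<alpha> Y0 W T n l'"
    and "0 \<le> t" "t \<le> T"
  shows "l t = l' t"
proof -
  define G where "G l i = measure M {\<omega> \<in> space M.
      hitting_time {0..T} (mv_path \<alpha> Y0 W l \<omega>) < ereal (mesh T n i)}" for l i
  have cong: "G l i = G l' i" if "\<And>t. 0 \<le> t \<Longrightarrow> t < mesh T n i \<Longrightarrow> l t = l' t" for i
    unfolding G_def using that by (simp add: hitting_event_cong[of "mesh T n i" l l'])
  have eq: "l t = G l i" "l' t = G l' i" if "i < n" "t \<in> {mesh T n i..<mesh T n (Suc i)}" for i t
    using assms(3,4) that unfolding bridge_scheme_def G_def by blast+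
  have *: "\<forall>t. 0 \<le> t \<and> t < mesh T n k \<longrightarrow> l t = l' t" if "k \<le> n" for k
    using that
  proof (induction k)
    case 0
    then show ?case by (simp add: mesh_def)
  next
    case (Suc k)
    have "l t = l' t" if "0 \<le> t" "t < mesh T n (Suc k)" for t
    proof (cases "t < mesh T n k")
      case True
      then show ?thesis using Suc that by simp
    next
      case False
      then have "l t = G l k" "l' t = G l' k" using eq[of k t] Suc.prems that by simp_all
      moreover have "G l k = G l' k" using Suc by (intro cong) simp
      ultimately show ?thesis by simp
    qed
    then show ?case by blast
  qed
  have "l (mesh T n n) = G l n" "l' (mesh T n n) = G l' n"
    using assms(3,4) unfolding bridge_scheme_def G_def by blast+
  moreover have "G l n = G l' n" using *[of n] by (intro cong) simp
  ultimately show ?thesis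
    using *[of n] assms mesh_last[OF \<open>n > 0\<close>, of T] by (cases "t = T") auto
qed

end

theory Submission
  imports Defs
begin

text \<open>
  Both loss functions are probabilities that the initial value lies below a random barrier: the
  path hits 0 before \<open>t\<close> exactly if \<open>Y\<^sub>0 \<le> \<alpha> L\<^sub>s - W\<^sub>s\<close> for some \<open>s < t\<close>, and likewise for the
  scheme.  The scheme evaluates its loss function with a delay, so its barrier lies below that of
  the solution, and inductively its loss is at most \<open>L\<close>.

  Suppose that the two loss functions differ by at most \<open>E\<close> before the mesh point \<open>t\<close>.  A path
  that is hit under the solution but not under the scheme then starts in the window
  \<open>[m - \<alpha> E, m]\<close>, where \<open>m\<close> is the supremum of \<open>\<alpha> L\<^sub>s - W\<^sub>s\<close> over \<open>s < t\<close>.  Since \<open>Y\<^sub>0\<close> is independent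
  of \<open>m\<close> and has a density that is at most \<open>B m\<^sup>\<beta>\<close> on this window, the probability of the window is at
  most \<open>\<alpha> E B\<close> times the mean of \<open>m\<^sup>\<beta>\<close> (\<open>prob_near_barrier\<close>).  By Levy's maximal inequality
  the mean of the supremum of \<open>-W\<close> over \<open>[0, T]\<close> is at most that of \<open>\<bar>W\<^sub>T\<bar>\<close>, which is \<open>sqrt (2 T / \<pi>)\<close>
  (\<open>brownian_expected_max\<close>); with the growth bound on \<open>L\<close> and Jensen's inequality, the error at
  \<open>t\<close> is at most \<open>q E\<close>, where \<open>q\<close> is the expression that defines \<open>T\<^sup>*\<close>, evaluated at \<open>T\<close>
  (\<open>bridge_scheme_step_error\<close>).  The condition \<open>T < T\<^sup>*\<close> says precisely that \<open>q < 1\<close>.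

  Within a cell of the mesh the scheme is constant, while \<open>L\<close> increases by at most
  \<open>w = K h powr ((1 + \<beta>) / 2)\<close>, by the bound on its weak derivative (\<open>loss_Hoelder\<close>).  So the
  error at the mesh points satisfies \<open>e \<le> q (e + w)\<close>, and \<open>e \<le> q w / (1 - q)\<close> follows by induction
  along the mesh (\<open>bridge_scheme_error\<close>), with the rate of \<open>w\<close>.
\<close>

section \<open>Increments of monotone functions with a weak derivative bounded above\<close>

lemma sqr_pos_part_deriv:
  "((\<lambda>x::real. (max 0 x)\<^sup>2) has_real_derivative 2 * max 0 x) (at x)"
proof -
  consider "x < 0" | "x > 0" | "x = 0" by linarith
  then show ?thesis
  proof cases
    case 1
    have "((\<lambda>x::real. 0) has_real_derivative 2 * max 0 x) (at x)" using 1 by simp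
    moreover have "\<forall>\<^sub>F y in nhds x. 0 = (max 0 y)\<^sup>2"
      by (rule eventually_mono[OF eventually_nhds_in_open[of "{..<0}" x]]) (use 1 in auto)
    ultimately show ?thesis using DERIV_cong_ev[of x x "\<lambda>x. 0" "\<lambda>x. (max 0 x)\<^sup>2"] by blast
  next
    case 2
    have "((\<lambda>x::real. x\<^sup>2) has_real_derivative 2 * max 0 x) (at x)" using 2
      by (auto intro!: derivative_eq_intros)
    moreover have "\<forall>\<^sub>F y in nhds x. y\<^sup>2 = (max 0 y)\<^sup>2"
      by (rule eventually_mono[OF eventually_nhds_in_open[of "{0<..}" x]]) (use 2 in auto)
    ultimately show ?thesis using DERIV_cong_ev[of x x "\<lambda>x. x\<^sup>2" "\<lambda>x. (max 0 x)\<^sup>2"] by blast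
  next
    case 3
    have "((\<lambda>h::real. \<bar>h\<bar>) \<longlongrightarrow> 0) (at 0)" by (auto intro!: tendsto_eq_intros)
    then have "((\<lambda>h::real. (max 0 h)\<^sup>2 / h) \<longlongrightarrow> 0) (at 0)"
      by (rule Lim_null_comparison[rotated])
        (auto simp: max_def power2_eq_square intro!: always_eventually)
    then show ?thesis using 3 by (simp add: DERIV_def)
  qed
qed

text \<open>
  The simplest continuously differentiable transition from \<open>0\<close> to \<open>1\<close> on the unit interval: a
  quadratic spline with knots \<open>0\<close>, \<open>1/2\<close>, \<open>1\<close>, whose derivative is piecewise linear.  It is the
  building block of the test functions below.
\<close>

definition smooth_step :: "real \<Rightarrow> real" where
  "smooth_step x = 2 * ((max 0 x)\<^sup>2 - 2 * (max 0 (x - 1/2))\<^sup>2 + (max 0 (x - 1))\<^sup>2)"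

definition tent :: "real \<Rightarrow> real" where
  "tent x = 4 * (max 0 x - 2 * max 0 (x - 1/2) + max 0 (x - 1))"

lemma smooth_step_deriv: "(smooth_step has_real_derivative tent x) (at x)"
proof -
  have "((\<lambda>x. (max 0 (x - c))\<^sup>2) has_real_derivative 2 * max 0 (x - c)) (at x)" for c :: real
    using DERIV_shift[of "\<lambda>x. (max 0 x)\<^sup>2" "2 * max 0 (x - c)" x "-c"]
      sqr_pos_part_deriv[of "x - c"] by simp
  note d = this
  show ?thesis
    unfolding smooth_step_def tent_def
    by (rule DERIV_cong[OF DERIV_cmult[OF DERIV_add[OF DERIV_diff[OF sqr_pos_part_deriv
          DERIV_cmult[OF d]] d]]]) simp
qed

lemma tent_nonneg: "0 \<le> tent x"
  and tent_outside: "x \<le> 0 \<or> 1 \<le> x \<Longrightarrow> tent x = 0"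
  by (auto simp: tent_def max_def)

lemma smooth_step_left: "x \<le> 0 \<Longrightarrow> smooth_step x = 0"
  by (simp add: smooth_step_def)

lemma smooth_step_right: "1 \<le> x \<Longrightarrow> smooth_step x = 1"
  by (simp add: smooth_step_def power2_eq_square algebra_simps)

lemma continuous_on_tent: "continuous_on A tent"
  unfolding tent_def by (intro continuous_intros)

lemma smooth_step_mono: "x \<le> y \<Longrightarrow> smooth_step x \<le> smooth_step y"
  using DERIV_nonneg_imp_nondecreasing smooth_step_deriv tent_nonneg by metis

lemma smooth_step_bounds: "0 \<le> smooth_step x" "smooth_step x \<le> 1"
  using smooth_step_mono[of "min 0 x" x] smooth_step_mono[of x "max 1 x"]
  by (simp_all add: smooth_step_left smooth_step_right)

lemma set_integrable_mult_continuous: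
  fixes u g :: "real \<Rightarrow> real"
  assumes "set_integrable lborel K u" "compact K" "continuous_on UNIV g"
  shows "set_integrable lborel K (\<lambda>x. u x * g x)"
proof -
  have "compact (g ` K)"
    using assms by (intro compact_continuous_image) (auto intro: continuous_on_subset)
  then obtain C where C: "\<And>x. x \<in> K \<Longrightarrow> \<bar>g x\<bar> \<le> C"
    by (force dest: compact_imp_bounded simp: bounded_iff)
  have "g \<in> borel_measurable borel" using assms(3) by (rule borel_measurable_continuous_onI)
  then have m: "g \<in> borel_measurable lborel" by simp
  have "integrable lborel (\<lambda>x. C * (indicator K x *\<^sub>R u x))"
    using assms(1) by (simp add: set_integrable_def)
  then show ?thesis unfolding set_integrable_def
  proof (rule Bochner_Integration.integrable_bound)
    have "(\<lambda>x. (indicator K x *\<^sub>R u x) * g x) \<in> borel_measurable lborel"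
      using assms(1) m unfolding set_integrable_def by (intro borel_measurable_times) auto
    then show "(\<lambda>x. indicator K x *\<^sub>R (u x * g x)) \<in> borel_measurable lborel"
      by (simp add: mult.assoc)
    show "AE x in lborel. norm (indicator K x *\<^sub>R (u x * g x)) \<le> norm (C * (indicator K x *\<^sub>R u x))"
    proof (rule AE_I2)
      fix x
      have "\<bar>u x\<bar> * \<bar>g x\<bar> \<le> \<bar>C\<bar> * \<bar>u x\<bar>" if "x \<in> K"
        using C[OF that] by (metis abs_ge_self abs_ge_zero mult.commute mult_right_mono order_trans)
      then show "norm (indicator K x *\<^sub>R (u x * g x)) \<le> norm (C * (indicator K x *\<^sub>R u x))"
        by (auto simp: indicator_def abs_mult)
    qed
  qed
qed


text \<open>
  The weak derivative is tested against a smoothed indicator of \<open>{s..t}\<close> that rises on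
  \<open>[s - \<epsilon>, s]\<close> and falls on \<open>[t, t + \<epsilon>]\<close>.  Its derivative compares an average of \<open>u\<close> over
  \<open>[s - \<epsilon>, s]\<close> with one over \<open>[t, t + \<epsilon>]\<close>, and monotonicity turns these averages into
  bounds by the values \<open>u s\<close> and \<open>u t\<close>.  This gives a statement about every \<open>s\<close> and \<open>t\<close>,
  although the weak derivative only sees \<open>u\<close> up to null sets.
\<close>

lemma weak_derivative_increment_le:
  assumes wd: "weak_derivative I u v" and "open I" and mono: "mono_on I u"
    and "s \<le> t" and st: "{s..t} \<subseteq> I" and "a < s" and "0 \<le> c"
    and v: "AE x in lborel. x \<in> I \<and> a < x \<longrightarrow> v x \<le> c"
  shows "u t - u s \<le> c * (t - s)"
proof -
  have "s \<in> I" "t \<in> I" using st \<open>s \<le> t\<close> by auto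
  then obtain e1 e2 where e: "0 < e1" "ball s e1 \<subseteq> I" "0 < e2" "ball t e2 \<subseteq> I"
    using \<open>open I\<close> by (metis open_contains_ball)
  have incr: "u t - u s \<le> c * (t - s + 2 * \<epsilon>)"
    if \<epsilon>: "0 < \<epsilon>" "\<epsilon> < e1" "\<epsilon> < e2" "\<epsilon> < s - a" for \<epsilon>
  proof -
    define K where "K = {s - \<epsilon> .. t + \<epsilon>}"
    have "x \<in> I" if "x \<in> K" for x
    proof -
      consider "x < s" | "s \<le> x" "x \<le> t" | "t < x" by linarith
      then show ?thesis
        using e st that \<epsilon> by cases (force simp: K_def dist_real_def)+
    qed
    then have K: "compact K" "K \<subseteq> I" by (auto simp: K_def)
    define g1 g2 where "g1 x = tent ((x - (s - \<epsilon>)) / \<epsilon>) / \<epsilon>"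
      and "g2 x = tent ((x - t) / \<epsilon>) / \<epsilon>" for x
    define G1 G2 where "G1 x = smooth_step ((x - (s - \<epsilon>)) / \<epsilon>)"
      and "G2 x = smooth_step ((x - t) / \<epsilon>)" for x
    have G: "(G1 has_real_derivative g1 x) (at x)" "(G2 has_real_derivative g2 x) (at x)" for x
    proof -
      have "((\<lambda>x. smooth_step ((x - c) / \<epsilon>)) has_real_derivative tent ((x - c) / \<epsilon>) / \<epsilon>) (at x)" for c
      proof -
        have "((\<lambda>x. (x - c) / \<epsilon>) has_real_derivative 1 / \<epsilon>) (at x)"
          using DERIV_cdivide[OF DERIV_diff[OF DERIV_ident DERIV_const]] by force
        then show ?thesis
          using DERIV_chain2[OF smooth_step_deriv] by force
      qed
      then show "(G1 has_real_derivative g1 x) (at x)" "(G2 has_real_derivative g2 x) (at x)"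
        unfolding G1_def G2_def g1_def g2_def by blast+
    qed
    have cont: "continuous_on UNIV g1" "continuous_on UNIV g2"
      unfolding g1_def g2_def
      by (intro continuous_intros continuous_on_compose2[OF continuous_on_tent[of UNIV]]; use \<epsilon> in simp)+
    have G1: "G1 x = 0" if "x \<le> s - \<epsilon>" for x
      unfolding G1_def using that \<epsilon> by (intro smooth_step_left) (simp add: field_simps)
    have G1': "G1 x = 1" if "s \<le> x" for x
      unfolding G1_def using that \<epsilon> by (intro smooth_step_right) (simp add: field_simps)
    have G2: "G2 x = 0" if "x \<le> t" for x
      unfolding G2_def using that \<epsilon> by (intro smooth_step_left) (simp add: field_simps)
    have G2': "G2 x = 1" if "t + \<epsilon> \<le> x" for x
      unfolding G2_def using that \<epsilon> by (intro smooth_step_right) (simp add: field_simps)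
    have g1: "g1 x = 0" if "x \<le> s - \<epsilon> \<or> s \<le> x" for x
      using that \<epsilon> by (auto simp: g1_def field_simps intro!: tent_outside)
    have g2: "g2 x = 0" if "x \<le> t \<or> t + \<epsilon> \<le> x" for x
      using that \<epsilon> by (auto simp: g2_def field_simps intro!: tent_outside)
    have g_nonneg: "0 \<le> g1 x" "0 \<le> g2 x" for x
      using \<epsilon> by (simp_all add: g1_def g2_def tent_nonneg)
    define \<phi> \<phi>' where "\<phi> x = G1 x - G2 x" and "\<phi>' x = g1 x - g2 x" for x
    have \<phi>: "(\<phi> has_real_derivative \<phi>' x) (at x)" for x
      unfolding \<phi>_def \<phi>'_def by (intro DERIV_diff G)
    have cont': "continuous_on UNIV \<phi>'" "continuous_on UNIV \<phi>"
    proof -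
      show "continuous_on UNIV \<phi>'" unfolding \<phi>'_def by (intro continuous_intros cont)
      show "continuous_on UNIV \<phi>"
        using \<phi> by (intro continuous_at_imp_continuous_on) (blast intro: DERIV_isCont)
    qed
    have zero: "\<phi> x = 0" "\<phi>' x = 0" if "x \<notin> K" for x
      using that \<open>s \<le> t\<close> \<epsilon> G1[of x] G1'[of x] G2[of x] G2'[of x] g1[of x] g2[of x]
      by (auto simp: \<phi>_def \<phi>'_def K_def not_le)
    have \<phi>_bounds: "0 \<le> \<phi> x" "\<phi> x \<le> 1" for x
    proof -
      show "0 \<le> \<phi> x"
        using G1'[of x] G2[of x] \<open>s \<le> t\<close> smooth_step_bounds
        by (cases "x \<le> t") (auto simp: \<phi>_def G1_def G2_def)
      show "\<phi> x \<le> 1"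
        using smooth_step_bounds[of "(x - (s - \<epsilon>)) / \<epsilon>"] smooth_step_bounds[of "(x - t) / \<epsilon>"]
        by (auto simp: \<phi>_def G1_def G2_def)
    qed
    have int: "set_integrable lborel K u" "set_integrable lborel K v"
      using wd K unfolding weak_derivative_def by blast+
    have "(LINT x:I|lborel. u x * \<phi>' x) = - (LINT x:I|lborel. v x * \<phi> x)"
      using wd \<phi> cont' K zero unfolding weak_derivative_def by blast
    moreover have "(LINT x:I|lborel. u x * \<phi>' x) = (LINT x:K|lborel. u x * \<phi>' x)"
      and "(LINT x:I|lborel. v x * \<phi> x) = (LINT x:K|lborel. v x * \<phi> x)"
      unfolding set_lebesgue_integral_def
      by (rule Bochner_Integration.integral_cong; use K zero in \<open>auto simp: indicator_def\<close>)+
    ultimately have parts: "(LINT x:K|lborel. u x * \<phi>' x) = - (LINT x:K|lborel. v x * \<phi> x)" by simp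
    have "(LINT x:K|lborel. u x * \<phi>' x) \<le> (LINT x:K|lborel. u s * g1 x - u t * g2 x)"
    proof (rule set_integral_mono)
      show "set_integrable lborel K (\<lambda>x. u x * \<phi>' x)"
        by (rule set_integrable_mult_continuous) (use int K cont' in auto)
      show "set_integrable lborel K (\<lambda>x. u s * g1 x - u t * g2 x)"
        by (intro borel_integrable_compact[unfolded set_integrable_def[symmetric]] K continuous_intros
            continuous_on_subset[OF cont(1)] continuous_on_subset[OF cont(2)]) auto
      fix x assume "x \<in> K"
      then have "x \<in> I" using K by blast
      have "u x * g1 x \<le> u s * g1 x"
      proof (cases "x \<le> s")
        case True
        then have "u x \<le> u s" using mono \<open>x \<in> I\<close> \<open>s \<in> I\<close> by (auto dest: mono_onD)
        then show ?thesis by (intro mult_right_mono g_nonneg)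
      qed (use g1 in auto)
      moreover have "u t * g2 x \<le> u x * g2 x"
      proof (cases "t \<le> x")
        case True
        then have "u t \<le> u x" using mono \<open>x \<in> I\<close> \<open>t \<in> I\<close> by (auto dest: mono_onD)
        then show ?thesis by (intro mult_right_mono g_nonneg)
      qed (use g2 in auto)
      ultimately show "u x * \<phi>' x \<le> u s * g1 x - u t * g2 x"
        by (simp add: \<phi>'_def right_diff_distrib)
    qed
    also have "\<dots> = u s - u t"
    proof -
      have "(\<integral>x. (u s * g1 x - u t * g2 x) * indicator {s - \<epsilon> .. t + \<epsilon>} x \<partial>lborel) =
          (u s * G1 (t + \<epsilon>) - u t * G2 (t + \<epsilon>)) - (u s * G1 (s - \<epsilon>) - u t * G2 (s - \<epsilon>))"
        using cont \<open>s \<le> t\<close> \<epsilon> G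
        by (intro integral_FTC_Icc_real)
          (auto intro!: DERIV_diff DERIV_cmult continuous_intros simp: continuous_on_eq_continuous_at)
      also have "\<dots> = u s - u t"
        using \<open>s \<le> t\<close> \<epsilon> by (simp add: G1 G1' G2 G2')
      finally show ?thesis
        by (simp add: set_lebesgue_integral_def K_def mult.commute)
    qed
    finally have "u t - u s \<le> (LINT x:K|lborel. v x * \<phi> x)" using parts by simp
    also have "\<dots> \<le> (LINT x:K|lborel. c)"
      unfolding set_lebesgue_integral_def
    proof (rule integral_mono_AE)
      show "integrable lborel (\<lambda>x. indicat_real K x *\<^sub>R (v x * \<phi> x))"
        using set_integrable_mult_continuous[OF int(2) K(1) cont'(2)] by (simp add: set_integrable_def)
      show "integrable lborel (\<lambda>x. indicat_real K x *\<^sub>R c)"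
        using borel_integrable_compact[OF K(1), of "\<lambda>_. c"] by simp
      show "AE x in lborel. indicat_real K x *\<^sub>R (v x * \<phi> x) \<le> indicat_real K x *\<^sub>R c"
        using v
      proof eventually_elim
        case (elim x)
        show ?case
        proof (cases "x \<in> K")
          case True
          then have "v x \<le> c" using elim K \<epsilon> by (auto simp: K_def)
          then have "v x * \<phi> x \<le> c * \<phi> x" using \<phi>_bounds by (intro mult_right_mono)
          also have "\<dots> \<le> c * 1" using \<phi>_bounds \<open>0 \<le> c\<close> by (intro mult_left_mono)
          finally show ?thesis using True by simp
        qed simp
      qed
    qed
    also have "\<dots> = c * (t - s + 2 * \<epsilon>)"
      using \<open>s \<le> t\<close> \<epsilon> by (simp add: set_lebesgue_integral_def K_def)
    finally show ?thesis .
  qed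
  have "((\<lambda>\<epsilon>. c * (t - s + 2 * \<epsilon>)) \<longlongrightarrow> c * (t - s + 2 * 0)) (at_right 0)"
    by (intro tendsto_intros)
  moreover have "\<forall>\<^sub>F \<epsilon> in at_right 0. u t - u s \<le> c * (t - s + 2 * \<epsilon>)"
  proof -
    have "\<forall>\<^sub>F \<epsilon> in at_right 0. \<epsilon> \<in> {0<..<min (min e1 e2) (s - a)}"
      using e \<open>a < s\<close> by (intro eventually_at_right_real) auto
    then show ?thesis by (rule eventually_mono) (auto intro: incr)
  qed
  ultimately show ?thesis
    using tendsto_lowerbound[of "\<lambda>\<epsilon>. c * (t - s + 2 * \<epsilon>)" _ "at_right 0" "u t - u s"] by simp
qed

section \<open>Events described by continuous paths\<close>

lemma ex_greater_dense_iff: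
  fixes g :: "real \<Rightarrow> real"
  assumes "continuous_on S g" "D \<subseteq> S" "S \<subseteq> closure D"
  shows "(\<exists>s\<in>S. a < g s) \<longleftrightarrow> (\<exists>s\<in>D. a < g s)"
proof
  assume "\<exists>s\<in>S. a < g s"
  then obtain s where s: "s \<in> S" "a < g s" by blast
  then obtain x where x: "\<And>n. x n \<in> D" "x \<longlonglongrightarrow> s"
    using assms(3) closure_sequential by (metis subsetD)
  have "(\<lambda>n. g (x n)) \<longlonglongrightarrow> g s"
    using assms(1) s(1) x assms(2) by (auto simp: continuous_on_sequentially o_def)
  then have "\<forall>\<^sub>F n in sequentially. a < g (x n)"
    using s(2) by (rule order_tendstoD)
  then show "\<exists>s\<in>D. a < g s"
    using x(1) unfolding eventually_sequentially by blast
qed (use assms in auto)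

text \<open>By continuity, crossing a level strictly is decided on a countable dense set of times.\<close>

lemma sets_ex_greater:
  fixes X :: "real \<Rightarrow> 'a \<Rightarrow> real"
  assumes cont: "\<And>\<omega>. \<omega> \<in> space M \<Longrightarrow> continuous_on S (\<lambda>s. X s \<omega>)"
    and meas: "\<And>s. s \<in> S \<Longrightarrow> X s \<in> borel_measurable M"
  shows "{\<omega> \<in> space M. \<exists>s\<in>S. a < X s \<omega>} \<in> sets M"
proof -
  obtain D where D: "countable D" "D \<subseteq> S" "S \<subseteq> closure D" by (rule separable)
  have "{\<omega> \<in> space M. \<exists>s\<in>S. a < X s \<omega>} = (\<Union>s\<in>D. {\<omega> \<in> space M. a < X s \<omega>})"
    using ex_greater_dense_iff[OF cont D(2,3)] by blast
  also have "\<dots> \<in> sets M"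
    using D meas by (intro sets.countable_UN') (auto intro!: borel_measurable_less)
  finally show ?thesis .
qed

lemma borel_measurable_SUP_continuous:
  fixes X :: "real \<Rightarrow> 'a \<Rightarrow> real"
  assumes "\<And>\<omega>. \<omega> \<in> space M \<Longrightarrow> continuous_on S (\<lambda>s. X s \<omega>)"
    and "\<And>s. s \<in> S \<Longrightarrow> X s \<in> borel_measurable M"
    and "\<And>\<omega>. \<omega> \<in> space M \<Longrightarrow> bdd_above ((\<lambda>s. X s \<omega>) ` S)" and "S \<noteq> {}"
  shows "(\<lambda>\<omega>. SUP s\<in>S. X s \<omega>) \<in> borel_measurable M"
  unfolding borel_measurable_iff_greater
proof
  fix a
  have "{\<omega> \<in> space M. a < (SUP s\<in>S. X s \<omega>)} = {\<omega> \<in> space M. \<exists>s\<in>S. a < X s \<omega>}"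
    using less_cSUP_iff[OF assms(4,3)] by blast
  then show "{\<omega> \<in> space M. a < (SUP s\<in>S. X s \<omega>)} \<in> sets M"
    using sets_ex_greater[OF assms(1,2)] by simp
qed

text \<open>
  Reaching a level weakly on a compact set is a countable intersection of strict crossings,
  because the minimum is attained.
\<close>

lemma ex_le_compact_iff:
  fixes g :: "real \<Rightarrow> real"
  assumes "compact S" "continuous_on S g"
  shows "(\<exists>s\<in>S. g s \<le> c) \<longleftrightarrow> (\<forall>n. \<exists>s\<in>S. g s < c + 1 / real (Suc n))"
proof
  assume "\<exists>s\<in>S. g s \<le> c"
  then obtain s where "s \<in> S" "g s \<le> c" by blast
  then show "\<forall>n. \<exists>s\<in>S. g s < c + 1 / real (Suc n)"
    by (intro allI bexI[of _ s]) (auto intro: le_less_trans)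
next
  assume r: "\<forall>n. \<exists>s\<in>S. g s < c + 1 / real (Suc n)"
  then have "S \<noteq> {}" by blast
  then obtain s where s: "s \<in> S" "\<And>t. t \<in> S \<Longrightarrow> g s \<le> g t"
    using continuous_attains_inf[OF assms(1) _ assms(2)] by blast
  have "g s \<le> c + 1 / real (Suc n)" for n using r s(2) by (meson le_less_trans less_imp_le)
  moreover have "(\<lambda>n. c + 1 / real (Suc n)) \<longlonglongrightarrow> c + 0"
    by (intro tendsto_intros LIMSEQ_Suc[OF lim_1_over_n])
  ultimately have "g s \<le> c" by (intro LIMSEQ_le_const[of "\<lambda>n. c + 1 / real (Suc n)"]) auto
  then show "\<exists>s\<in>S. g s \<le> c" using s by blast
qed

lemma sets_ex_le_compact:
  fixes X :: "real \<Rightarrow> 'a \<Rightarrow> real"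
  assumes cont: "\<And>\<omega>. \<omega> \<in> space M \<Longrightarrow> continuous_on S (\<lambda>s. X s \<omega>)"
    and meas: "\<And>s. s \<in> S \<Longrightarrow> X s \<in> borel_measurable M" and "compact S"
  shows "{\<omega> \<in> space M. \<exists>s\<in>S. X s \<omega> \<le> c} \<in> sets M"
proof -
  have "{\<omega> \<in> space M. \<exists>s\<in>S. X s \<omega> < c'} \<in> sets M" for c'
  proof -
    have "{\<omega> \<in> space M. \<exists>s\<in>S. - c' < - X s \<omega>} \<in> sets M"
      by (rule sets_ex_greater) (use cont meas in \<open>simp_all add: continuous_on_minus\<close>)
    then show ?thesis by simp
  qed
  then have "{\<omega> \<in> space M. \<forall>n. \<exists>s\<in>S. X s \<omega> < c + 1 / real (Suc n)} \<in> sets M"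
    by (intro sets.sets_Collect_countable_All)
  moreover have "{\<omega> \<in> space M. \<exists>s\<in>S. X s \<omega> \<le> c} =
      {\<omega> \<in> space M. \<forall>n. \<exists>s\<in>S. X s \<omega> < c + 1 / real (Suc n)}"
    using ex_le_compact_iff[OF \<open>compact S\<close> cont] by (intro Collect_cong conj_cong refl) blast
  ultimately show ?thesis by simp
qed

text \<open>
  The paths of the scheme are continuous only on half-open cells of the mesh, where the infimum
  need not be attained; the cell is exhausted by compact intervals.
\<close>

lemma sets_ex_le_Ico:
  fixes X :: "real \<Rightarrow> 'a \<Rightarrow> real"
  assumes cont: "\<And>\<omega>. \<omega> \<in> space M \<Longrightarrow> continuous_on {a..<b} (\<lambda>s. X s \<omega>)"
    and meas: "\<And>s. s \<in> {a..<b} \<Longrightarrow> X s \<in> borel_measurable M"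
  shows "{\<omega> \<in> space M. \<exists>s\<in>{a..<b}. X s \<omega> \<le> c} \<in> sets M"
proof -
  define S where "S n = {a..b - 1 / real (Suc n)}" for n
  have S: "S n \<subseteq> {a..<b}" for n
  proof
    fix s assume "s \<in> S n"
    moreover have "0 < 1 / real (Suc n)" by simp
    ultimately show "s \<in> {a..<b}" unfolding S_def atLeastAtMost_iff atLeastLessThan_iff by linarith
  qed
  moreover have "\<exists>n. s \<in> S n" if s: "s \<in> {a..<b}" for s
  proof -
    have "0 < b - s" using s by simp
    from reals_Archimedean[OF this] obtain n where n: "1 / real (Suc n) < b - s"
      unfolding inverse_eq_divide by (rule exE)
    have "a \<le> s" "s \<le> b - 1 / real (Suc n)" using s n by simp_all
    then show ?thesis unfolding S_def by (intro exI[of _ n]) (rule atLeastAtMost_iff[THEN iffD2, OF conjI])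
  qed
  ultimately have "{a..<b} = (\<Union>n. S n)" by fast
  then have "{\<omega> \<in> space M. \<exists>s\<in>{a..<b}. X s \<omega> \<le> c} =
      (\<Union>n. {\<omega> \<in> space M. \<exists>s\<in>S n. X s \<omega> \<le> c})"
    by (simp only: bex_UN Collect_ex_eq[symmetric]) auto
  moreover have "{\<omega> \<in> space M. \<exists>s\<in>S n. X s \<omega> \<le> c} \<in> sets M" for n
  proof (rule sets_ex_le_compact)
    show "continuous_on (S n) (\<lambda>s. X s \<omega>)" if "\<omega> \<in> space M" for \<omega>
      using cont[OF that] S by (rule continuous_on_subset)
    show "X s \<in> borel_measurable M" if "s \<in> S n" for s
      using S[of n] that by (intro meas) (rule subsetD)
    show "compact (S n)" by (simp add: S_def)
  qed
  ultimately show ?thesis by (simp add: sets.countable_UN)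
qed

section \<open>The expected maximum of Brownian motion\<close>

lemma (in prob_space) normal_symmetric:
  assumes X: "distributed M lborel X (normal_density 0 \<sigma>)" and "0 < \<sigma>"
  shows "prob {\<omega> \<in> space M. X \<omega> < - a} = prob {\<omega> \<in> space M. a < X \<omega>}"
proof -
  have X': "distributed M lborel (\<lambda>\<omega>. - X \<omega>) (normal_density 0 \<sigma>)"
    using normal_density_affine[OF X \<open>0 < \<sigma>\<close>, of "-1" 0] by simp
  have "emeasure M ((\<lambda>\<omega>. - X \<omega>) -` {a<..} \<inter> space M) = emeasure M (X -` {a<..} \<inter> space M)"
    using distributed_emeasure[OF X, of "{a<..}"] distributed_emeasure[OF X', of "{a<..}"] by simp
  moreover have "(\<lambda>\<omega>. - X \<omega>) -` {a<..} \<inter> space M = {\<omega> \<in> space M. X \<omega> < - a}"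
    "X -` {a<..} \<inter> space M = {\<omega> \<in> space M. a < X \<omega>}" by auto
  ultimately show ?thesis by (simp add: measure_def)
qed

lemma (in prob_space) normal_le_0:
  assumes X: "distributed M lborel X (normal_density 0 \<sigma>)" and "0 < \<sigma>"
  shows "1 / 2 \<le> prob {\<omega> \<in> space M. X \<omega> \<le> 0}"
proof -
  have [measurable]: "X \<in> borel_measurable M" using distributed_measurable[OF X] by simp
  have "prob {\<omega> \<in> space M. X \<omega> < 0} \<le> prob {\<omega> \<in> space M. X \<omega> \<le> 0}"
    by (intro finite_measure_mono) auto
  moreover have "prob {\<omega> \<in> space M. X \<omega> < 0} = prob {\<omega> \<in> space M. 0 < X \<omega>}"
    using normal_symmetric[OF assms, of 0] by simp
  moreover have "prob {\<omega> \<in> space M. 0 < X \<omega>} = 1 - prob {\<omega> \<in> space M. X \<omega> \<le> 0}"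
    by (subst prob_compl[symmetric]) (auto intro!: arg_cong[where f=prob])
  ultimately show ?thesis by simp
qed

lemma (in prob_space) normal_abs_tail:
  assumes X: "distributed M lborel X (normal_density 0 \<sigma>)" and "0 < \<sigma>" and "0 \<le> a"
  shows "prob {\<omega> \<in> space M. a < \<bar>X \<omega>\<bar>} = 2 * prob {\<omega> \<in> space M. X \<omega> < - a}"
proof -
  have [measurable]: "X \<in> borel_measurable M" using distributed_measurable[OF X] by simp
  have "{\<omega> \<in> space M. a < \<bar>X \<omega>\<bar>} = {\<omega> \<in> space M. X \<omega> < - a} \<union> {\<omega> \<in> space M. a < X \<omega>}"
    using \<open>0 \<le> a\<close> by auto
  also have "prob \<dots> = prob {\<omega> \<in> space M. X \<omega> < - a} + prob {\<omega> \<in> space M. a < X \<omega>}"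
    using \<open>0 \<le> a\<close> by (intro finite_measure_Union) auto
  finally show ?thesis using normal_symmetric[OF assms(1,2)] by simp
qed

lemma brownian_measurable:
  assumes "filtered_prob_space M F" "standard_brownian_motion M F W" "0 \<le> s"
  shows "s \<le> t \<Longrightarrow> W s \<in> borel_measurable (F t)" "W s \<in> borel_measurable M"
proof -
  have sub: "subalgebra M (F t)" if "0 \<le> t" for t
    using assms that unfolding filtered_prob_space_def by blast
  have W: "W s \<in> borel_measurable (F s)"
    using assms unfolding standard_brownian_motion_def by blast
  then show "W s \<in> borel_measurable M"
    using measurable_from_subalg[OF sub[OF \<open>0 \<le> s\<close>]] by blast
  assume "s \<le> t"
  then have "subalgebra (F t) (F s)"
    using assms(1,3) sub[of s] sub[of t]
    unfolding filtered_prob_space_def subalgebra_def by auto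
  then show "W s \<in> borel_measurable (F t)" using W measurable_from_subalg by blast
qed

lemma brownian_continuous:
  assumes "standard_brownian_motion M F W" "\<omega> \<in> space M" "S \<subseteq> {0..}"
  shows "continuous_on S (\<lambda>s. W s \<omega>)"
proof -
  have "continuous_on {0..} (\<lambda>s. W s \<omega>)"
    using assms unfolding standard_brownian_motion_def by blast
  then show ?thesis using assms(3) by (rule continuous_on_subset)
qed

text \<open>
  Levy's maximal inequality, the half of the reflection principle that survives without the
  strong Markov property.  Decompose by the first time \<open>k\<close> in \<open>K\<close> at which \<open>W 0 - W k\<close> exceeds
  \<open>a\<close>.  The remaining increment is independent of this event and non-positive with probability at
  least \<open>1/2\<close>; in that case \<open>W 0 - W T\<close> exceeds \<open>a\<close> as well.
\<close>

lemma brownian_finite_max_tail: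
  assumes fps: "filtered_prob_space M F" and bm: "standard_brownian_motion M F W"
    and "0 < T" and K: "finite K" "K \<subseteq> {0..T}" and "0 \<le> a"
  shows "measure M {\<omega> \<in> space M. \<exists>s\<in>K. a < W 0 \<omega> - W s \<omega>}
    \<le> measure M {\<omega> \<in> space M. a < \<bar>W T \<omega> - W 0 \<omega>\<bar>}"
proof -
  interpret prob_space M using fps by (simp add: filtered_prob_space_def)
  have incr: "distributed M lborel (\<lambda>\<omega>. W t \<omega> - W s \<omega>) (normal_density 0 (sqrt (t - s)))"
    "indep_set (sets (F s)) {(\<lambda>\<omega>. W t \<omega> - W s \<omega>) -` A \<inter> space M | A. A \<in> sets borel}"
    if "0 \<le> s" "s < t" for s t
    using bm that unfolding standard_brownian_motion_def by blast+
  have meas[measurable]: "W s \<in> borel_measurable M" if "0 \<le> s" for s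
    using brownian_measurable[OF fps bm that] by blast
  note meas[OF order_refl, measurable]
  have T[measurable]: "W T \<in> borel_measurable M" using meas \<open>0 < T\<close> by simp
  \<comment> \<open>\<open>A k\<close>: the level is first exceeded at \<open>k\<close>; \<open>D k\<close>: the path does not rise between \<open>k\<close> and \<open>T\<close>\<close>
  define A where "A k = {\<omega> \<in> space M. a < W 0 \<omega> - W k \<omega> \<and> (\<forall>j\<in>{j\<in>K. j < k}. W 0 \<omega> - W j \<omega> \<le> a)}" for k
  define D where "D k = {\<omega> \<in> space M. W T \<omega> - W k \<omega> \<le> 0}" for k
  have A_F: "A k \<in> sets (F k)" if "k \<in> K" for k
  proof -
    have k: "0 \<le> k" using that K by auto
    then have sp: "space (F k) = space M"
      using fps unfolding filtered_prob_space_def subalgebra_def by blast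
    have [measurable]: "W j \<in> borel_measurable (F k)" if "0 \<le> j" "j \<le> k" for j
      using brownian_measurable(1)[OF fps bm that] .
    have "{\<omega> \<in> space (F k). a < W 0 \<omega> - W k \<omega> \<and> (\<forall>j\<in>{j\<in>K. j < k}. W 0 \<omega> - W j \<omega> \<le> a)} \<in> sets (F k)"
      using K k by (intro sets.sets_Collect_conj sets.sets_Collect_finite_All) (auto intro!: borel_measurable_less borel_measurable_le)
    then show ?thesis by (simp add: A_def sp)
  qed
  have A[measurable]: "A k \<in> sets M" if "k \<in> K" for k
  proof -
    have "0 \<le> k" using that K by auto
    then show ?thesis
      using A_F[OF that] fps unfolding filtered_prob_space_def subalgebra_def by blast
  qed
  have D[measurable]: "D k \<in> sets M" if "k \<in> K" for k
  proof -
    have [measurable]: "W k \<in> borel_measurable M" using that K by (intro meas) auto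
    show ?thesis unfolding D_def by measurable
  qed
  have disj: "disjoint_family_on A K"
    unfolding disjoint_family_on_def A_def by (auto, metis linorder_neqE not_le)
  have "{\<omega> \<in> space M. \<exists>s\<in>K. a < W 0 \<omega> - W s \<omega>} = (\<Union>k\<in>K. A k)"
  proof (intro equalityI subsetI)
    fix \<omega> assume "\<omega> \<in> {\<omega> \<in> space M. \<exists>s\<in>K. a < W 0 \<omega> - W s \<omega>}"
    then have \<omega>: "\<omega> \<in> space M" "{s\<in>K. a < W 0 \<omega> - W s \<omega>} \<noteq> {}" by auto
    define k where "k = Min {s\<in>K. a < W 0 \<omega> - W s \<omega>}"
    have "k \<in> {s\<in>K. a < W 0 \<omega> - W s \<omega>}"
      unfolding k_def using K \<omega> by (intro Min_in) auto
    moreover have "W 0 \<omega> - W j \<omega> \<le> a" if "j \<in> K" "j < k" for j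
    proof (rule ccontr)
      assume "\<not> W 0 \<omega> - W j \<omega> \<le> a"
      then have "k \<le> j" unfolding k_def using that K by (intro Min_le) auto
      then show False using that by simp
    qed
    ultimately show "\<omega> \<in> (\<Union>k\<in>K. A k)" using \<omega> by (auto simp: A_def)
  qed (auto simp: A_def)
  then have "prob {\<omega> \<in> space M. \<exists>s\<in>K. a < W 0 \<omega> - W s \<omega>} = (\<Sum>k\<in>K. prob (A k))"
    using finite_measure_finite_Union[OF K(1) _ disj] A by (simp add: image_subset_iff)
  also have "\<dots> \<le> (\<Sum>k\<in>K. 2 * prob (A k \<inter> D k))"
  proof (rule sum_mono)
    fix k assume k: "k \<in> K"
    show "prob (A k) \<le> 2 * prob (A k \<inter> D k)"
    proof (cases "k = T")
      case True
      then have "A k \<inter> D k = A k" by (auto simp: A_def D_def)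
      then show ?thesis by simp
    next
      case False
      then have kT: "0 \<le> k" "k < T" using k K by force+
      have "D k = (\<lambda>\<omega>. W T \<omega> - W k \<omega>) -` {..0} \<inter> space M" by (auto simp: D_def)
      moreover have "{..0::real} \<in> sets borel" by simp
      ultimately have "D k \<in> {(\<lambda>\<omega>. W T \<omega> - W k \<omega>) -` A \<inter> space M | A. A \<in> sets borel}"
        unfolding mem_Collect_eq by (intro exI[of _ "{..0}"] conjI)
      then have "prob (A k \<inter> D k) = prob (A k) * prob (D k)"
        by (rule indep_setD[OF incr(2)[OF kT] A_F[OF k]])
      moreover have "1 / 2 \<le> prob (D k)"
        unfolding D_def using normal_le_0[OF incr(1)[OF kT]] kT by simp
      ultimately show ?thesis
        using mult_left_mono[of "1/2" "prob (D k)" "prob (A k)"] by simp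
    qed
  qed
  also have "\<dots> = 2 * prob (\<Union>k\<in>K. A k \<inter> D k)"
  proof -
    have "disjoint_family_on (\<lambda>k. A k \<inter> D k) K"
      using disj unfolding disjoint_family_on_def by blast
    moreover have "(\<lambda>k. A k \<inter> D k) ` K \<subseteq> sets M" using A D by blast
    ultimately show ?thesis
      using finite_measure_finite_Union[OF K(1), of "\<lambda>k. A k \<inter> D k"]
      by (simp add: sum_distrib_left)
  qed
  also have "\<dots> \<le> 2 * prob {\<omega> \<in> space M. W T \<omega> - W 0 \<omega> < - a}"
    by (intro mult_left_mono finite_measure_mono) (auto simp: A_def D_def)
  also have "\<dots> = prob {\<omega> \<in> space M. a < \<bar>W T \<omega> - W 0 \<omega>\<bar>}"
    using normal_abs_tail[OF incr(1)[OF order_refl \<open>0 < T\<close>]] \<open>0 < T\<close> \<open>0 \<le> a\<close> by simp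
  finally show ?thesis .
qed

lemma brownian_max_tail:
  assumes fps: "filtered_prob_space M F" and bm: "standard_brownian_motion M F W"
    and "0 < T" and "0 \<le> a"
  shows "measure M {\<omega> \<in> space M. \<exists>s\<in>{0..T}. a < W 0 \<omega> - W s \<omega>}
    \<le> measure M {\<omega> \<in> space M. a < \<bar>W T \<omega> - W 0 \<omega>\<bar>}"
proof -
  interpret prob_space M using fps by (simp add: filtered_prob_space_def)
  obtain D where D: "countable D" "D \<subseteq> {0..T}" "{0..T} \<subseteq> closure D" by (rule separable)
  then have "D \<noteq> {}" using \<open>0 < T\<close> by auto
  define E where "E n = {\<omega> \<in> space M. \<exists>s\<in>from_nat_into D ` {..n}. a < W 0 \<omega> - W s \<omega>}" for n
  have sub: "from_nat_into D ` {..n} \<subseteq> {0..T}" for n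
    using from_nat_into[OF \<open>D \<noteq> {}\<close>] D by auto
  have cont: "continuous_on {0..T} (\<lambda>s. W 0 \<omega> - W s \<omega>)" if "\<omega> \<in> space M" for \<omega>
    by (intro continuous_intros brownian_continuous[OF bm that]) auto
  have meas: "W s \<in> borel_measurable M" if "0 \<le> s" for s
    using brownian_measurable[OF fps bm that] by blast
  have E_sets: "E n \<in> sets M" for n
    unfolding E_def using sub[of n]
    by (intro sets.sets_Collect_finite_Ex) (auto intro!: borel_measurable_less borel_measurable_diff meas)
  have "{\<omega> \<in> space M. \<exists>s\<in>{0..T}. a < W 0 \<omega> - W s \<omega>} = {\<omega> \<in> space M. \<exists>s\<in>D. a < W 0 \<omega> - W s \<omega>}"
    using ex_greater_dense_iff[OF cont D(2,3)] by blast
  also have "\<dots> = (\<Union>n. E n)"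
  proof -
    have "D = range (from_nat_into D)" using D \<open>D \<noteq> {}\<close> by (simp add: range_from_nat_into)
    then show ?thesis unfolding E_def by blast
  qed
  finally have eq: "{\<omega> \<in> space M. \<exists>s\<in>{0..T}. a < W 0 \<omega> - W s \<omega>} = (\<Union>n. E n)" .
  have "(\<lambda>n. prob (E n)) \<longlonglongrightarrow> prob (\<Union>n. E n)"
  proof (rule finite_Lim_measure_incseq)
    have "E m \<subseteq> E n" if "m \<le> n" for m n
    proof -
      have "from_nat_into D ` {..m} \<subseteq> from_nat_into D ` {..n}" using that by (intro image_mono) simp
      then show ?thesis unfolding E_def by blast
    qed
    then show "incseq E" by (simp add: incseq_def)
  qed (use E_sets in auto)
  moreover have "prob (E n) \<le> prob {\<omega> \<in> space M. a < \<bar>W T \<omega> - W 0 \<omega>\<bar>}" for n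
    unfolding E_def using sub by (intro brownian_finite_max_tail[OF fps bm]) (use assms in auto)
  ultimately show ?thesis
    unfolding eq by (intro LIMSEQ_le_const2) auto
qed

text \<open>Tonelli's theorem for the region below the graph of \<open>X\<close>.\<close>

lemma (in sigma_finite_measure) nn_integral_layer_cake:
  assumes [measurable]: "X \<in> borel_measurable M"
  shows "(\<integral>\<^sup>+\<omega>. ennreal (X \<omega>) \<partial>M) =
    (\<integral>\<^sup>+a. indicator {0..} a * emeasure M {\<omega> \<in> space M. a < X \<omega>} \<partial>lborel)"
proof -
  interpret pair_sigma_finite M lborel ..
  have "(\<integral>\<^sup>+\<omega>. ennreal (X \<omega>) \<partial>M) =
      (\<integral>\<^sup>+\<omega>. \<integral>\<^sup>+a. indicator {0..} a * indicator {\<omega> \<in> space M. a < X \<omega>} \<omega> \<partial>lborel \<partial>M)"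
  proof (rule nn_integral_cong)
    fix \<omega> assume "\<omega> \<in> space M"
    then have "(\<integral>\<^sup>+a. indicator {0..} a * indicator {\<omega> \<in> space M. a < X \<omega>} \<omega> \<partial>lborel) =
        (\<integral>\<^sup>+a. indicator {0..<X \<omega>} a \<partial>lborel)"
      by (intro nn_integral_cong) (auto simp: indicator_def)
    also have "\<dots> = ennreal (X \<omega>)"
      by (cases "0 \<le> X \<omega>") (auto simp: ennreal_neg)
    finally show "ennreal (X \<omega>) = (\<integral>\<^sup>+a. indicator {0..} a * indicator {\<omega> \<in> space M. a < X \<omega>} \<omega> \<partial>lborel)"
      by simp
  qed
  also have "\<dots> = (\<integral>\<^sup>+a. \<integral>\<^sup>+\<omega>. indicator {0..} a * indicator {\<omega> \<in> space M. a < X \<omega>} \<omega> \<partial>M \<partial>lborel)"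
    by (rule Fubini'[symmetric]) (simp add: indicator_def split_beta' cong: measurable_cong)
  also have "\<dots> = (\<integral>\<^sup>+a. indicator {0..} a * emeasure M {\<omega> \<in> space M. a < X \<omega>} \<partial>lborel)"
    by (simp add: nn_integral_cmult)
  finally show ?thesis .
qed

lemma brownian_paths_bounded:
  assumes "standard_brownian_motion M F W" "\<omega> \<in> space M"
  shows "bdd_above ((\<lambda>s. W 0 \<omega> - W s \<omega>) ` {0..T})"
proof -
  have "continuous_on {0..T} (\<lambda>s. W 0 \<omega> - W s \<omega>)"
    by (intro continuous_intros brownian_continuous[OF assms]) auto
  then have "compact ((\<lambda>s. W 0 \<omega> - W s \<omega>) ` {0..T})"
    by (rule compact_continuous_image) simp
  then show ?thesis by (intro bounded_imp_bdd_above compact_imp_bounded)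
qed

lemma brownian_max_measurable:
  assumes fps: "filtered_prob_space M F" and bm: "standard_brownian_motion M F W" and "0 < T"
  shows "(\<lambda>\<omega>. SUP s\<in>{0..T}. W 0 \<omega> - W s \<omega>) \<in> borel_measurable M"
proof (rule borel_measurable_SUP_continuous)
  show "continuous_on {0..T} (\<lambda>s. W 0 \<omega> - W s \<omega>)" if "\<omega> \<in> space M" for \<omega>
    by (intro continuous_intros brownian_continuous[OF bm that]) auto
qed (use assms brownian_measurable[OF fps bm] brownian_paths_bounded[OF bm] in auto)

text \<open>
  By the maximal inequality the running maximum is stochastically dominated by \<open>\<bar>W T - W 0\<bar>\<close>,
  whose mean is the first absolute moment of a normal variable with variance \<open>T\<close>.  The sharp
  constant is essential: it is the one that occurs in the definition of \<open>T\<^sup>*\<close>.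
\<close>

lemma brownian_expected_max:
  assumes fps: "filtered_prob_space M F" and bm: "standard_brownian_motion M F W" and "0 < T"
  shows "(\<integral>\<^sup>+\<omega>. ennreal (SUP s\<in>{0..T}. W 0 \<omega> - W s \<omega>) \<partial>M) \<le> ennreal (sqrt (2 * T / pi))"
proof -
  interpret prob_space M using fps by (simp add: filtered_prob_space_def)
  define S where "S \<omega> = (SUP s\<in>{0..T}. W 0 \<omega> - W s \<omega>)" for \<omega>
  have S[measurable]: "S \<in> borel_measurable M"
    unfolding S_def using brownian_max_measurable[OF assms] .
  have W[measurable]: "W 0 \<in> borel_measurable M" "W T \<in> borel_measurable M"
    using brownian_measurable[OF fps bm] \<open>0 < T\<close> by auto
  have "(\<integral>\<^sup>+\<omega>. ennreal (S \<omega>) \<partial>M) \<le> (\<integral>\<^sup>+\<omega>. ennreal \<bar>W T \<omega> - W 0 \<omega>\<bar> \<partial>M)"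
  proof -
    have "indicator {0..} a * emeasure M {\<omega> \<in> space M. a < S \<omega>}
        \<le> indicator {0..} a * emeasure M {\<omega> \<in> space M. a < \<bar>W T \<omega> - W 0 \<omega>\<bar>}" for a
    proof (cases "0 \<le> a")
      case True
      have "{\<omega> \<in> space M. a < S \<omega>} = {\<omega> \<in> space M. \<exists>s\<in>{0..T}. a < W 0 \<omega> - W s \<omega>}"
        unfolding S_def using less_cSUP_iff[OF _ brownian_paths_bounded[OF bm]] \<open>0 < T\<close>
        by (intro Collect_cong conj_cong) auto
      then show ?thesis
        using brownian_max_tail[OF assms True] True
        by (simp add: emeasure_eq_measure ennreal_leI)
    qed simp
    then show ?thesis
      by (subst (1 2) nn_integral_layer_cake) (auto intro!: nn_integral_mono)
  qed
  also have "\<dots> = (\<integral>\<^sup>+x. normal_density 0 (sqrt T) x * ennreal \<bar>x\<bar> \<partial>lborel)"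
  proof -
    have "distributed M lborel (\<lambda>\<omega>. W T \<omega> - W 0 \<omega>) (normal_density 0 (sqrt (T - 0)))"
      using bm \<open>0 < T\<close> unfolding standard_brownian_motion_def by blast
    then show ?thesis by (subst distributed_nn_integral[symmetric]) auto
  qed
  also have "\<dots> = ennreal (sqrt (2 * T / pi))"
  proof -
    have "has_bochner_integral lborel (\<lambda>x. normal_density 0 (sqrt T) x * \<bar>x\<bar>) (sqrt T * sqrt (2 / pi))"
      using normal_moment_abs_odd[of "sqrt T" 0 0] \<open>0 < T\<close> by simp
    then have "(\<integral>\<^sup>+x. ennreal (normal_density 0 (sqrt T) x * \<bar>x\<bar>) \<partial>lborel) = ennreal (sqrt T * sqrt (2 / pi))"
      by (subst nn_integral_eq_integral) (auto simp: has_bochner_integral_iff)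
    then show ?thesis
      by (simp add: ennreal_mult' real_sqrt_mult[symmetric] mult.commute)
  qed
  finally show ?thesis by (simp add: S_def)
qed

section \<open>The scheme on the mesh\<close>

lemma mesh_interval:
  assumes "0 < T" "0 \<le> s" "s < mesh T n i"
  shows "\<exists>j<i. s \<in> {mesh T n j..<mesh T n (Suc j)}"
  using assms(3)
proof (induction i)
  case 0
  then show ?case using assms by (simp add: mesh_def)
next
  case (Suc i)
  then show ?case using less_Suc_eq by (cases "s < mesh T n i") auto
qed

lemma bridge_scheme_mesh:
  assumes "0 < n" "0 < T" "bridge_scheme M \<alpha> Y0 W T n Lb" "i \<le> n"
  shows "Lb (mesh T n i) = measure M {\<omega> \<in> space M.
    hitting_time {0..T} (mv_path \<alpha> Y0 W Lb \<omega>) < ereal (mesh T n i)}"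
proof (cases "i = n")
  case False
  then have "mesh T n i \<in> {mesh T n i..<mesh T n (Suc i)}"
    using mesh_less[OF assms(2,1), of i "Suc i"] by simp
  then show ?thesis using assms False unfolding bridge_scheme_def by auto
qed (use assms in \<open>simp add: bridge_scheme_def\<close>)

lemma bridge_scheme_step:
  assumes "0 < n" "0 < T" "bridge_scheme M \<alpha> Y0 W T n Lb" "j < n"
    and "s \<in> {mesh T n j..<mesh T n (Suc j)}"
  shows "Lb s = Lb (mesh T n j)"
proof -
  have "Lb s = measure M {\<omega> \<in> space M.
      hitting_time {0..T} (mv_path \<alpha> Y0 W Lb \<omega>) < ereal (mesh T n j)}"
    using assms(3-5) unfolding bridge_scheme_def by blast
  then show ?thesis using bridge_scheme_mesh[OF assms(1-3), of j] assms(4) by simp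
qed

text \<open>
  Measurability of the events in the scheme is part of its content, because the measure of a
  non-measurable set is 0.  On each cell the barrier is constant and the path continuous.
\<close>

lemma bridge_scheme_event_sets:
  assumes fps: "filtered_prob_space M F" and bm: "standard_brownian_motion M F W"
    and Y0: "Y0 \<in> borel_measurable M"
    and "0 < n" "0 < T" and scheme: "bridge_scheme M \<alpha> Y0 W T n Lb" and "i \<le> n"
  shows "{\<omega> \<in> space M. hitting_time {0..T} (mv_path \<alpha> Y0 W Lb \<omega>) < ereal (mesh T n i)} \<in> sets M"
proof -
  have nonneg: "0 \<le> mesh T n j" for j
    using \<open>0 < T\<close> by (simp add: mesh_def)
  define A where "A j = {\<omega> \<in> space M. \<exists>s\<in>{mesh T n j..<mesh T n (Suc j)}.
      Y0 \<omega> + W s \<omega> \<le> \<alpha> * Lb (mesh T n j)}" for j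
  have "A j \<in> sets M" for j
    unfolding A_def
  proof (rule sets_ex_le_Ico)
    show "continuous_on {mesh T n j..<mesh T n (Suc j)} (\<lambda>s. Y0 \<omega> + W s \<omega>)" if "\<omega> \<in> space M" for \<omega>
      using nonneg[of j] by (intro continuous_intros brownian_continuous[OF bm that]) auto
    show "(\<lambda>\<omega>. Y0 \<omega> + W s \<omega>) \<in> borel_measurable M" if "s \<in> {mesh T n j..<mesh T n (Suc j)}" for s
      using nonneg[of j] that by (intro borel_measurable_add Y0 brownian_measurable(2)[OF fps bm]) auto
  qed
  then have "(\<Union>j<i. A j) \<in> sets M" by auto
  also have "(\<Union>j<i. A j) = {\<omega> \<in> space M. hitting_time {0..T} (mv_path \<alpha> Y0 W Lb \<omega>) < ereal (mesh T n i)}"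
  proof (intro equalityI subsetI)
    fix \<omega> assume "\<omega> \<in> (\<Union>j<i. A j)"
    then obtain j s where js: "j < i" "\<omega> \<in> space M" "s \<in> {mesh T n j..<mesh T n (Suc j)}"
      "Y0 \<omega> + W s \<omega> \<le> \<alpha> * Lb (mesh T n j)" by (auto simp: A_def)
    have "s < mesh T n i" "mesh T n i \<le> T"
      using js mesh_mono[OF \<open>0 < T\<close>, of "Suc j" i n] mesh_mono[OF \<open>0 < T\<close> \<open>i \<le> n\<close>, of n]
        mesh_last[OF \<open>0 < n\<close>, of T] by auto
    moreover have "mv_path \<alpha> Y0 W Lb \<omega> s \<le> 0"
      using js bridge_scheme_step[OF assms(4,5) scheme _ js(3)] \<open>i \<le> n\<close> by (simp add: mv_path_def)
    ultimately show "\<omega> \<in> {\<omega> \<in> space M. hitting_time {0..T} (mv_path \<alpha> Y0 W Lb \<omega>) < ereal (mesh T n i)}"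
      using js nonneg[of j] by (auto simp: hitting_time_less_iff intro!: bexI[of _ s])
  next
    fix \<omega> assume "\<omega> \<in> {\<omega> \<in> space M. hitting_time {0..T} (mv_path \<alpha> Y0 W Lb \<omega>) < ereal (mesh T n i)}"
    then obtain s where s: "\<omega> \<in> space M" "0 \<le> s" "s < mesh T n i" "mv_path \<alpha> Y0 W Lb \<omega> s \<le> 0"
      by (auto simp: hitting_time_less_iff)
    then obtain j where j: "j < i" "s \<in> {mesh T n j..<mesh T n (Suc j)}"
      using mesh_interval[OF \<open>0 < T\<close>] by blast
    then have "Y0 \<omega> + W s \<omega> \<le> \<alpha> * Lb (mesh T n j)"
      using s bridge_scheme_step[OF assms(4,5) scheme _ j(2)] \<open>i \<le> n\<close> by (simp add: mv_path_def)
    then have "\<omega> \<in> A j" using j s(1) unfolding A_def by blast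
    then show "\<omega> \<in> (\<Union>j<i. A j)" using j(1) by blast
  qed
  finally show ?thesis .
qed

section \<open>The probability of starting just below a random barrier\<close>

text \<open>
  Jensen's inequality for the concave function \<open>x powr \<beta>\<close>, by integrating its tangent at \<open>\<mu>\<close>.  Taking
  the tangent at the upper bound \<open>\<mu>\<close> rather than at the mean covers the mean 0, where there is none.
\<close>

lemma (in prob_space) nn_integral_powr_le:
  assumes [measurable]: "X \<in> borel_measurable M" and X: "\<And>\<omega>. \<omega> \<in> space M \<Longrightarrow> 0 \<le> X \<omega>"
    and "0 < \<mu>" and "0 < \<beta>" "\<beta> \<le> 1" and EX: "(\<integral>\<^sup>+\<omega>. ennreal (X \<omega>) \<partial>M) \<le> ennreal \<mu>"
  shows "(\<integral>\<^sup>+\<omega>. ennreal (X \<omega> powr \<beta>) \<partial>M) \<le> ennreal (\<mu> powr \<beta>)"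
proof -
  have tangent: "x powr \<beta> \<le> \<mu> powr (\<beta> - 1) * \<beta> * x + (1 - \<beta>) * \<mu> powr \<beta>" if "0 \<le> x" for x
  proof (cases "x = 0")
    case False
    then have young: "x powr \<beta> * \<mu> powr (1 - \<beta>) \<le> \<beta> * x + (1 - \<beta>) * \<mu>"
      using that assms(3-5) by (intro Youngs_inequality_0) auto
    have inv: "\<mu> powr (\<beta> - 1) * \<mu> powr (1 - \<beta>) = 1"
      using \<open>0 < \<mu>\<close> by (simp flip: powr_add)
    have pow: "\<mu> powr (\<beta> - 1) * \<mu> = \<mu> powr \<beta>"
      using \<open>0 < \<mu>\<close> by (simp add: powr_diff)
    have "x powr \<beta> = \<mu> powr (\<beta> - 1) * (x powr \<beta> * \<mu> powr (1 - \<beta>))"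
      using inv by (simp add: mult.left_commute)
    also have "\<dots> \<le> \<mu> powr (\<beta> - 1) * (\<beta> * x + (1 - \<beta>) * \<mu>)"
      using young by (rule mult_left_mono) simp
    also have "\<dots> = \<mu> powr (\<beta> - 1) * \<beta> * x + (1 - \<beta>) * (\<mu> powr (\<beta> - 1) * \<mu>)"
      by (simp add: algebra_simps)
    finally show ?thesis by (simp only: pow)
  qed (use assms(4,5) in simp)
  have "(\<integral>\<^sup>+\<omega>. ennreal (X \<omega> powr \<beta>) \<partial>M)
      \<le> (\<integral>\<^sup>+\<omega>. ennreal (\<mu> powr (\<beta> - 1) * \<beta>) * ennreal (X \<omega>) + ennreal ((1 - \<beta>) * \<mu> powr \<beta>) \<partial>M)"
    using tangent X \<open>0 < \<beta>\<close> \<open>\<beta> \<le> 1\<close>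
    by (intro nn_integral_mono) (simp add: ennreal_mult'[symmetric] ennreal_plus[symmetric] del: ennreal_plus)
  also have "\<dots> = ennreal (\<mu> powr (\<beta> - 1) * \<beta>) * (\<integral>\<^sup>+\<omega>. ennreal (X \<omega>) \<partial>M) + ennreal ((1 - \<beta>) * \<mu> powr \<beta>)"
    by (subst nn_integral_add) (auto simp: nn_integral_cmult emeasure_space_1)
  also have "\<dots> \<le> ennreal (\<mu> powr (\<beta> - 1) * \<beta>) * ennreal \<mu> + ennreal ((1 - \<beta>) * \<mu> powr \<beta>)"
    by (intro add_mono mult_left_mono EX) auto
  also have "\<dots> = ennreal (\<mu> powr (\<beta> - 1) * \<beta> * \<mu> + (1 - \<beta>) * \<mu> powr \<beta>)"
    using assms(3-5) by (simp add: ennreal_mult'[symmetric] ennreal_plus[symmetric] del: ennreal_plus)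
  also have "\<mu> powr (\<beta> - 1) * \<beta> * \<mu> + (1 - \<beta>) * \<mu> powr \<beta> = \<mu> powr \<beta>"
    using \<open>0 < \<mu>\<close> by (simp add: powr_diff algebra_simps)
  finally show ?thesis .
qed

text \<open>
  The key estimate.  Given the barrier \<open>m\<close>, which is independent of \<open>Y0\<close>, the window
  \<open>[m - c, m]\<close> has length \<open>c\<close>, and on it the density is at most \<open>B m\<^sup>\<beta>\<close>.  Bounding the density at the
  upper end of the window keeps the estimate linear in \<open>c\<close> with the constant \<open>B \<mu>\<^sup>\<beta>\<close>.
\<close>

lemma (in prob_space) prob_near_barrier:
  fixes f :: "real \<Rightarrow> real"
  assumes Y0: "distributed M lborel Y0 f" and f0: "\<And>x. x < 0 \<Longrightarrow> f x = 0"
    and f: "\<And>x. 0 \<le> x \<Longrightarrow> f x \<le> B * x powr \<beta>"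
    and ind: "indep_var borel Y0 borel m"
    and "0 \<le> B" "0 < \<beta>" "\<beta> \<le> 1" "0 \<le> c" "0 < \<mu>"
    and X[measurable]: "X \<in> borel_measurable M" and X0: "\<And>\<omega>. \<omega> \<in> space M \<Longrightarrow> 0 \<le> X \<omega>"
    and mX: "AE \<omega> in M. m \<omega> \<le> X \<omega>" and EX: "(\<integral>\<^sup>+\<omega>. ennreal (X \<omega>) \<partial>M) \<le> ennreal \<mu>"
  shows "prob {\<omega> \<in> space M. m \<omega> - c \<le> Y0 \<omega> \<and> Y0 \<omega> \<le> m \<omega>} \<le> c * B * \<mu> powr \<beta>"
proof -
  have [measurable]: "Y0 \<in> borel_measurable M" "m \<in> borel_measurable M"
    using ind by (auto dest: indep_var_rv1 indep_var_rv2)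
  define P Q where "P = distr M borel Y0" and "Q = distr M borel m"
  interpret P: prob_space P unfolding P_def by (rule prob_space_distr) simp
  interpret Q: prob_space Q unfolding Q_def by (rule prob_space_distr) simp
  interpret PQ: pair_sigma_finite P Q ..
  have setsP[measurable_cong]: "sets P = sets borel" and setsQ[measurable_cong]: "sets Q = sets borel"
    by (simp_all add: P_def Q_def)
  define A :: "(real \<times> real) set" where "A = {p. snd p - c \<le> fst p \<and> fst p \<le> snd p}"
  have A: "A \<in> sets (borel \<Otimes>\<^sub>M borel)"
  proof -
    have "{p \<in> space (borel \<Otimes>\<^sub>M borel :: (real \<times> real) measure). snd p - c \<le> fst p \<and> fst p \<le> snd p}
        \<in> sets (borel \<Otimes>\<^sub>M borel)"
      by measurable
    then show ?thesis by (simp add: A_def space_pair_measure)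
  qed
  have joint: "P \<Otimes>\<^sub>M Q = distr M (borel \<Otimes>\<^sub>M borel) (\<lambda>\<omega>. (Y0 \<omega>, m \<omega>))"
    using ind unfolding indep_var_distribution_eq P_def Q_def by blast
  \<comment> \<open>\<open>max 0 z\<close> covers negative barriers, below which the density vanishes\<close>
  have window: "emeasure P {z - c..z} \<le> ennreal (B * max 0 z powr \<beta>) * ennreal c" for z
  proof -
    have "emeasure P {z - c..z} = emeasure M (Y0 -` {z - c..z} \<inter> space M)"
      unfolding P_def by (rule emeasure_distr) auto
    also have "\<dots> = (\<integral>\<^sup>+x. ennreal (f x) * indicator {z - c..z} x \<partial>lborel)"
      using distributed_emeasure[OF Y0] by simp
    also have "\<dots> \<le> (\<integral>\<^sup>+x. ennreal (B * max 0 z powr \<beta>) * indicator {z - c..z} x \<partial>lborel)"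
    proof (rule nn_integral_mono)
      fix x
      have "f x \<le> B * max 0 z powr \<beta>" if "x \<le> z"
      proof (cases "0 \<le> x")
        case True
        then have "x powr \<beta> \<le> max 0 z powr \<beta>" using that \<open>0 < \<beta>\<close> by (intro powr_mono2) auto
        then show ?thesis using f[OF True] \<open>0 \<le> B\<close> by (meson mult_left_mono order_trans)
      qed (use f0 \<open>0 \<le> B\<close> in simp)
      then show "ennreal (f x) * indicator {z - c..z} x \<le> ennreal (B * max 0 z powr \<beta>) * indicator {z - c..z} x"
        by (auto simp: indicator_def intro: ennreal_leI)
    qed
    also have "\<dots> = ennreal (B * max 0 z powr \<beta>) * ennreal c"
      using \<open>0 \<le> c\<close> by (simp add: nn_integral_cmult)
    finally show ?thesis .
  qed
  have "{\<omega> \<in> space M. m \<omega> - c \<le> Y0 \<omega> \<and> Y0 \<omega> \<le> m \<omega>} = (\<lambda>\<omega>. (Y0 \<omega>, m \<omega>)) -` A \<inter> space M"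
    by (auto simp: A_def)
  then have "emeasure M {\<omega> \<in> space M. m \<omega> - c \<le> Y0 \<omega> \<and> Y0 \<omega> \<le> m \<omega>} = emeasure (P \<Otimes>\<^sub>M Q) A"
    unfolding joint using A by (simp add: emeasure_distr)
  also have "\<dots> = (\<integral>\<^sup>+z. emeasure P ((\<lambda>y. (y, z)) -` A) \<partial>Q)"
    by (rule PQ.emeasure_pair_measure_alt2) (use A in \<open>simp add: sets_pair_measure_cong[OF setsP setsQ]\<close>)
  also have "\<dots> = (\<integral>\<^sup>+z. emeasure P {z - c..z} \<partial>Q)"
    by (intro nn_integral_cong arg_cong[where f="emeasure P"]) (auto simp: A_def)
  also have "\<dots> \<le> (\<integral>\<^sup>+z. ennreal (B * max 0 z powr \<beta>) * ennreal c \<partial>Q)"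
    by (intro nn_integral_mono window)
  also have "\<dots> = (\<integral>\<^sup>+\<omega>. ennreal (B * max 0 (m \<omega>) powr \<beta>) * ennreal c \<partial>M)"
    unfolding Q_def by (rule nn_integral_distr) auto
  also have "\<dots> \<le> (\<integral>\<^sup>+\<omega>. ennreal (c * B) * ennreal (X \<omega> powr \<beta>) \<partial>M)"
  proof (rule nn_integral_mono_AE)
    show "AE \<omega> in M. ennreal (B * max 0 (m \<omega>) powr \<beta>) * ennreal c \<le> ennreal (c * B) * ennreal (X \<omega> powr \<beta>)"
      using mX AE_space
    proof eventually_elim
      case (elim \<omega>)
      then have "max 0 (m \<omega>) powr \<beta> \<le> X \<omega> powr \<beta>"
        using X0 \<open>0 < \<beta>\<close> by (intro powr_mono2) auto
      then have "c * B * max 0 (m \<omega>) powr \<beta> \<le> c * B * X \<omega> powr \<beta>"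
        using \<open>0 \<le> B\<close> \<open>0 \<le> c\<close> by (intro mult_left_mono) auto
      then show ?case
        using \<open>0 \<le> B\<close> \<open>0 \<le> c\<close> by (simp add: ennreal_mult'[symmetric] ennreal_leI ac_simps)
    qed
  qed
  also have "\<dots> = ennreal (c * B) * (\<integral>\<^sup>+\<omega>. ennreal (X \<omega> powr \<beta>) \<partial>M)"
    by (rule nn_integral_cmult) simp
  also have "\<dots> \<le> ennreal (c * B) * ennreal (\<mu> powr \<beta>)"
    using assms by (intro mult_left_mono nn_integral_powr_le) auto
  also have "\<dots> = ennreal (c * B * \<mu> powr \<beta>)"
    using \<open>0 \<le> B\<close> \<open>0 \<le> c\<close> by (simp add: ennreal_mult)
  finally show ?thesis
    using \<open>0 \<le> B\<close> \<open>0 \<le> c\<close> by (simp add: emeasure_eq_measure)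
qed

lemma sigma_sets_vimage:
  assumes "f \<in> measurable M N"
  shows "sigma_sets (space M) {f -` A \<inter> space M | A. A \<in> sets N} = {f -` A \<inter> space M | A. A \<in> sets N}"
  using assms sets_vimage_algebra[of "space M" f N] sets_vimage_algebra2[of f "space M" N]
  by (auto simp: measurable_def)

text \<open>
  A supremum of a continuous path is a supremum over countably many times, hence measurable with
  respect to the sigma-algebra \<open>N\<close> generated by the process, which is independent of \<open>Y0\<close>.
\<close>

lemma indep_var_path_functional:
  assumes fps: "filtered_prob_space M F" and bm: "standard_brownian_motion M F W"
    and Y0: "Y0 \<in> borel_measurable M" and ind: "indep_of_process M Y0 W"
    and S: "S \<subseteq> {0..}" "S \<noteq> {}" and l: "continuous_on S l"
    and bdd: "\<And>\<omega>. \<omega> \<in> space M \<Longrightarrow> bdd_above ((\<lambda>s. l s - W s \<omega>) ` S)"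
  shows "prob_space.indep_var M borel Y0 borel (\<lambda>\<omega>. SUP s\<in>S. l s - W s \<omega>)"
proof -
  interpret prob_space M using fps by (simp add: filtered_prob_space_def)
  define m where "m \<omega> = (SUP s\<in>S. l s - W s \<omega>)" for \<omega>
  define path where "path \<omega> = (\<lambda>t\<in>{0..}. W t \<omega>)" for \<omega>
  define N where "N = vimage_algebra (space M) path (Pi\<^sub>M {0..} (\<lambda>_. borel))"
  have path_space: "path \<in> space M \<rightarrow> space (Pi\<^sub>M {0..} (\<lambda>_. borel))"
    by (auto simp: path_def space_PiM)
  have N: "space N = space M" "sets N = {path -` A \<inter> space M | A. A \<in> sets (Pi\<^sub>M {0..} (\<lambda>_. borel))}"
    unfolding N_def using sets_vimage_algebra2[OF path_space] by simp_all
  have cont: "continuous_on S (\<lambda>s. l s - W s \<omega>)" if "\<omega> \<in> space M" for \<omega>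
    by (intro continuous_intros l brownian_continuous[OF bm that] S)
  have W_N: "W s \<in> borel_measurable N" if "s \<in> S" for s
  proof -
    have s: "s \<in> {0..}" using that S by blast
    have "(\<lambda>\<omega>. path \<omega> s) \<in> borel_measurable N"
      by (rule measurable_compose[OF _ measurable_component_singleton[OF s]])
        (simp add: N_def measurable_vimage_algebra1[OF path_space])
    then show ?thesis using s by (simp add: path_def)
  qed
  have "m \<in> borel_measurable N"
    unfolding m_def
    by (rule borel_measurable_SUP_continuous) (use cont bdd S W_N N(1) in auto)
  have mM: "m \<in> borel_measurable M"
    unfolding m_def
    by (rule borel_measurable_SUP_continuous)
      (use cont bdd S brownian_measurable(2)[OF fps bm] in auto)
  have "indep_set {Y0 -` A \<inter> space M | A. A \<in> sets borel} {m -` A \<inter> space M | A. A \<in> sets borel}"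
  proof (rule indep_setI)
    show "{Y0 -` A \<inter> space M | A. A \<in> sets borel} \<subseteq> events"
      using Y0 by auto
    show "{m -` A \<inter> space M | A. A \<in> sets borel} \<subseteq> events"
      using mM by auto
    fix a b
    assume a: "a \<in> {Y0 -` A \<inter> space M | A. A \<in> sets borel}"
      and "b \<in> {m -` A \<inter> space M | A. A \<in> sets borel}"
    then have "b \<in> sets N"
      using measurable_sets[OF \<open>m \<in> borel_measurable N\<close>] N(1) by auto
    then show "prob (a \<inter> b) = prob a * prob b"
      using indep_setD[OF ind[unfolded indep_of_process_def] a, of b] N(2)
      by (simp add: path_def[abs_def])
  qed
  then have "indep_var borel Y0 borel m"
    unfolding indep_var_eq using Y0 mM by (simp add: sigma_sets_vimage)
  then show ?thesis unfolding m_def[abs_def] .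
qed

section \<open>Regularity of the loss function\<close>

lemma mckean_vlasov_loss_mono:
  assumes "prob_space M" "mckean_vlasov_solution M \<alpha> Y0 W J L" "s \<in> J" "t \<in> J" "s \<le> t"
  shows "L s \<le> L t"
proof -
  interpret prob_space M by fact
  show ?thesis
    using assms(2-5) unfolding mckean_vlasov_solution_def
    by (auto intro!: finite_measure_mono intro: order_trans)
qed

text \<open>
  Hoelder continuity with exponent \<open>(1 + \<beta>) / 2\<close> up to and including time 0.  If \<open>t - s \<le> s\<close>, the
  bound on the weak derivative is applied on \<open>(s/2, \<infinity>)\<close>, where it is at most a multiple of
  \<open>(t - s) powr (- (1 - \<beta>) / 2)\<close>; otherwise \<open>t \<le> 2 (t - s)\<close>, and the growth bound at 0 suffices.
\<close>

lemma loss_Hoelder: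
  fixes e :: ereal
  assumes mono: "\<And>s t. 0 \<le> s \<Longrightarrow> s \<le> t \<Longrightarrow> ereal t < e \<Longrightarrow> L s \<le> L t"
    and L: "\<And>t. 0 \<le> t \<Longrightarrow> ereal t < e \<Longrightarrow> 0 \<le> L t"
      "\<And>t. 0 \<le> t \<Longrightarrow> ereal t < e \<Longrightarrow> L t \<le> Bt * t powr ((1 + \<beta>) / 2)"
    and "0 < \<beta>" "\<beta> \<le> 1" "0 \<le> Bt"
    and wd: "weak_derivative {t. 0 < t \<and> ereal t < e} L L'"
    and L': "AE t in lborel. 0 < t \<and> ereal t < e \<longrightarrow> L' t \<le> Bhat * t powr (- ((1 - \<beta>) / 2))"
    and st: "0 \<le> s" "s \<le> t" "ereal t < e"
  shows "L t - L s \<le> (max 0 Bhat * 2 powr ((1 - \<beta>) / 2) + 2 * Bt) * (t - s) powr ((1 + \<beta>) / 2)"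
proof -
  define p \<gamma> where "p = (1 - \<beta>) / 2" and "\<gamma> = (1 + \<beta>) / 2"
  have p: "0 \<le> p" "0 \<le> \<gamma>" "\<gamma> \<le> 1" "\<gamma> = 1 - p"
    using assms(4,5) by (auto simp: p_def \<gamma>_def field_simps)
  define K where "K = max 0 Bhat"
  have "0 \<le> K" "Bhat \<le> K" by (auto simp: K_def)
  consider "s = t" | "s < t" "t - s \<le> s" | "s < t" "s < t - s" using st by linarith
  then have "L t - L s \<le> (K * 2 powr p + 2 * Bt) * (t - s) powr \<gamma>"
  proof cases
    case 1
    then show ?thesis using \<open>0 \<le> K\<close> \<open>0 \<le> Bt\<close> by simp
  next
    case 2
    define c where "c = K * ((t - s) / 2) powr (- p)"
    have "L t - L s \<le> c * (t - s)"
    proof (rule weak_derivative_increment_le[OF wd])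
      show "open {t. 0 < t \<and> ereal t < e}"
        by (intro open_Collect_conj open_Collect_less continuous_intros continuous_on_ereal)
      show "mono_on {t. 0 < t \<and> ereal t < e} L"
        by (intro mono_onI mono) auto
      show "{s..t} \<subseteq> {t. 0 < t \<and> ereal t < e}"
        using 2 st by (auto intro: le_less_trans[of _ "ereal t"])
      show "s / 2 < s" "0 \<le> c" "s \<le> t" using 2 \<open>0 \<le> K\<close> by (auto simp: c_def)
      show "AE x in lborel. x \<in> {t. 0 < t \<and> ereal t < e} \<and> s / 2 < x \<longrightarrow> L' x \<le> c"
        using L'
      proof eventually_elim
        case (elim x)
        have "L' x \<le> c" if x: "0 < x" "ereal x < e" "s / 2 < x"
        proof -
          have "L' x \<le> Bhat * x powr (- p)" using elim x by (simp add: p_def)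
          also have "\<dots> \<le> K * x powr (- p)" using \<open>Bhat \<le> K\<close> by (intro mult_right_mono) auto
          also have "\<dots> \<le> c"
            unfolding c_def using 2 x p \<open>0 \<le> K\<close> by (intro mult_left_mono powr_mono2') auto
          finally show ?thesis .
        qed
        then show ?case by blast
      qed
    qed
    also have "c * (t - s) = K * 2 powr p * (t - s) powr \<gamma>"
    proof -
      have "((t - s) / 2) powr (- p) = 2 powr p * (t - s) powr (- p)"
        using 2 by (simp add: powr_divide powr_minus field_simps)
      moreover have "(t - s) powr (- p) * (t - s) = (t - s) powr \<gamma>"
        using 2 p powr_add[of "t - s" "- p" 1] by simp
      ultimately show ?thesis by (simp add: c_def)
    qed
    also have "\<dots> \<le> (K * 2 powr p + 2 * Bt) * (t - s) powr \<gamma>"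
      using \<open>0 \<le> Bt\<close> by (intro mult_right_mono) auto
    finally show ?thesis .
  next
    case 3
    have "L t - L s \<le> Bt * t powr \<gamma>"
      using L(1)[of s] L(2)[of t] st le_less_trans[of "ereal s" "ereal t" e] by (auto simp: \<gamma>_def)
    also have "\<dots> \<le> Bt * (2 * (t - s)) powr \<gamma>"
      using 3 st p \<open>0 \<le> Bt\<close> by (intro mult_left_mono powr_mono2) auto
    also have "\<dots> = Bt * 2 powr \<gamma> * (t - s) powr \<gamma>"
      using powr_mult[of 2 "t - s" \<gamma>] 3 by simp
    also have "\<dots> \<le> Bt * 2 * (t - s) powr \<gamma>"
      using p \<open>0 \<le> Bt\<close> powr_mono[of \<gamma> 1 2] by (intro mult_right_mono mult_left_mono) auto
    also have "\<dots> \<le> (K * 2 powr p + 2 * Bt) * (t - s) powr \<gamma>"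
      using \<open>0 \<le> K\<close> by (intro mult_right_mono) auto
    finally show ?thesis .
  qed
  then show ?thesis by (simp add: K_def p_def \<gamma>_def)
qed

section \<open>Comparison of the scheme with the loss function\<close>

text \<open>
  The setting of the error analysis: the regularity of the loss function enters through the
  growth bound and the Hoelder bound, with a common exponent \<open>\<gamma>\<close>.
\<close>

locale mv_problem =
  fixes M :: "'a measure" and F :: "real \<Rightarrow> 'a measure"
    and W :: "real \<Rightarrow> 'a \<Rightarrow> real" and Y0 :: "'a \<Rightarrow> real"
    and f :: "real \<Rightarrow> real" and L :: "real \<Rightarrow> real" and J :: "real set"
    and \<alpha> \<beta> \<gamma> T B Bt K :: real
  assumes fps: "filtered_prob_space M F" and bm: "standard_brownian_motion M F W"
    and \<alpha>: "0 < \<alpha>" and T: "0 < T" and \<beta>: "0 < \<beta>" "\<beta> \<le> 1" and \<gamma>: "0 < \<gamma>"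
    and ind: "indep_of_process M Y0 W" and Y0: "distributed M lborel Y0 f"
    and f0: "\<And>x. x < 0 \<Longrightarrow> f x = 0" and f: "\<And>x. 0 \<le> x \<Longrightarrow> f x \<le> B * x powr \<beta>"
    and B: "0 \<le> B" and Bt: "0 \<le> Bt" and K: "0 \<le> K"
    and J: "J \<subseteq> {0..}" "{0..T} \<subseteq> J"
    and sol: "mckean_vlasov_solution M \<alpha> Y0 W J L"
    and L_le: "\<And>t. 0 \<le> t \<Longrightarrow> t \<le> T \<Longrightarrow> L t \<le> Bt * t powr \<gamma>"
    and L_Hoelder: "\<And>s t. 0 \<le> s \<Longrightarrow> s \<le> t \<Longrightarrow> t \<le> T \<Longrightarrow> L t - L s \<le> K * (t - s) powr \<gamma>"
begin

sublocale prob_space M using fps by (simp add: filtered_prob_space_def)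

lemma L_mono: "0 \<le> s \<Longrightarrow> s \<le> t \<Longrightarrow> t \<le> T \<Longrightarrow> L s \<le> L t"
  using J by (intro mckean_vlasov_loss_mono[OF prob_space_axioms sol]) auto

lemma L_nonneg: "0 \<le> t \<Longrightarrow> t \<le> T \<Longrightarrow> 0 \<le> L t"
  using sol J unfolding mckean_vlasov_solution_def by auto

lemma L_0: "L 0 = 0"
  using L_nonneg[of 0] L_le[of 0] T by simp

lemma L_continuous: "continuous_on {0..T} L"
  unfolding continuous_on_def
proof
  fix s assume s: "s \<in> {0..T}"
  have "((\<lambda>t. \<bar>t - s\<bar>) \<longlongrightarrow> \<bar>s - s\<bar>) (at s within {0..T})" by (intro tendsto_intros)
  then have "((\<lambda>t. \<bar>t - s\<bar> powr \<gamma>) \<longlongrightarrow> 0) (at s within {0..T})"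
    using \<gamma> by (intro tendsto_zero_powrI[where b=\<gamma>]) auto
  then have "((\<lambda>t. K * \<bar>t - s\<bar> powr \<gamma>) \<longlongrightarrow> 0) (at s within {0..T})"
    by (rule tendsto_mult_right_zero)
  moreover have "norm (L t - L s) \<le> K * \<bar>t - s\<bar> powr \<gamma>" if "t \<in> {0..T}" for t
    using s that L_Hoelder[of s t] L_Hoelder[of t s] L_mono[of s t] L_mono[of t s]
    by (cases "s \<le> t") (auto simp: abs_if)
  then have "\<forall>\<^sub>F t in at s within {0..T}. norm (L t - L s) \<le> K * \<bar>t - s\<bar> powr \<gamma>"
    by (auto simp: eventually_at_filter)
  ultimately have "((\<lambda>t. L t - L s) \<longlongrightarrow> 0) (at s within {0..T})"
    by (rule Lim_null_comparison[rotated])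
  then show "(L \<longlongrightarrow> L s) (at s within {0..T})" by (simp add: LIM_zero_iff)
qed

text \<open>
  The scheme uses the probability of a crossing strictly before \<open>t\<close>, the loss function that of a
  crossing up to \<open>t\<close>.  For the solution the two agree because the loss function is left-continuous.
\<close>

definition hit_before :: "real \<Rightarrow> 'a set" where
  "hit_before t = {\<omega> \<in> space M. hitting_time J (mv_path \<alpha> Y0 W L \<omega>) < ereal t}"

lemma hit_before:
  assumes "0 < t" "t \<le> T"
  shows hit_before_sets: "hit_before t \<in> sets M" and prob_hit_before: "prob (hit_before t) = L t"
proof -
  define H where "H r = {\<omega> \<in> space M. hitting_time J (mv_path \<alpha> Y0 W L \<omega>) \<le> ereal r}" for r
  have H: "H r \<in> sets M" "prob (H r) = L r" if "0 \<le> r" "r \<le> T" for r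
    using sol J that unfolding mckean_vlasov_solution_def H_def by auto
  \<comment> \<open>an increasing approximation of \<open>t\<close> that stays in \<open>[0, T]\<close>\<close>
  define r where "r n = t - t / real (Suc n)" for n
  have r: "0 \<le> r n" "r n < t" "r n \<le> T" for n
  proof -
    have "t / real (Suc n) \<le> t / 1" using assms by (intro divide_left_mono) auto
    moreover have "0 < t / real (Suc n)" using assms by simp
    ultimately show "0 \<le> r n" "r n < t" "r n \<le> T"
      unfolding r_def using assms by linarith+
  qed
  have r_lim: "r \<longlonglongrightarrow> t"
  proof -
    have "(\<lambda>n. t - t / real (Suc n)) \<longlonglongrightarrow> t - 0"
      by (intro tendsto_intros LIMSEQ_Suc[OF lim_const_over_n])
    then show ?thesis by (simp add: r_def[abs_def])
  qed
  have "hit_before t = (\<Union>n. H (r n))"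
  proof (intro equalityI subsetI)
    fix \<omega> assume "\<omega> \<in> hit_before t"
    then obtain s where s: "\<omega> \<in> space M" "s \<in> J" "s < t" "mv_path \<alpha> Y0 W L \<omega> s \<le> 0"
      by (auto simp: hit_before_def hitting_time_less_iff)
    have "\<forall>\<^sub>F n in sequentially. s < r n" using r_lim s(3) by (rule order_tendstoD)
    then obtain n where "s < r n" unfolding eventually_sequentially by blast
    moreover have "hitting_time J (mv_path \<alpha> Y0 W L \<omega>) \<le> ereal s"
      unfolding hitting_time_def using s by (intro Inf_lower) auto
    ultimately have "\<omega> \<in> H (r n)"
      using s(1) by (auto simp: H_def intro: order_trans less_imp_le)
    then show "\<omega> \<in> (\<Union>n. H (r n))" by blast
  next
    fix \<omega> assume "\<omega> \<in> (\<Union>n. H (r n))"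
    then show "\<omega> \<in> hit_before t"
      using r(2) by (auto simp: H_def hit_before_def intro: le_less_trans)
  qed
  then show sets: "hit_before t \<in> sets M" using H r by auto
  have "prob (hit_before t) \<le> L t"
  proof -
    have "hit_before t \<subseteq> H t" by (auto simp: hit_before_def H_def)
    then have "prob (hit_before t) \<le> prob (H t)"
      using H(1) assms by (intro finite_measure_mono) auto
    then show ?thesis using H(2)[of t] assms by simp
  qed
  moreover have "L t \<le> prob (hit_before t)"
  proof (rule LIMSEQ_le_const2)
    have "continuous_on {0..T} L" by (rule L_continuous)
    then show "(\<lambda>n. L (r n)) \<longlonglongrightarrow> L t"
      using r_lim r assms unfolding continuous_on_sequentially by (auto simp: o_def)
    show "\<exists>N. \<forall>n\<ge>N. L (r n) \<le> prob (hit_before t)"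
    proof (intro exI allI impI)
      fix n
      have "prob (H (r n)) \<le> prob (hit_before t)"
        using sets r(2)[of n] by (intro finite_measure_mono)
          (auto simp: H_def hit_before_def intro: le_less_trans)
      then show "L (r n) \<le> prob (hit_before t)" using H(2)[of "r n"] r by simp
    qed
  qed
  ultimately show "prob (hit_before t) = L t" by simp
qed

text \<open>
  A bound for the mean of \<open>\<alpha> L T + sup (W 0 - W s)\<close>, which almost surely dominates the barrier
  \<open>sup (\<alpha> L s - W s)\<close> that the initial value has to stay above.
\<close>

definition drift_bound :: real where
  "drift_bound = sqrt (2 * T / pi) + \<alpha> * Bt * T powr \<gamma>"

lemma drift_bound_pos: "0 < drift_bound"
  using T \<alpha> Bt by (auto simp: drift_bound_def intro!: add_pos_nonneg)

text \<open>
  The factor by which one step of the scheme multiplies a uniform error at most; it is the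
  left-hand side of the equation defining \<open>T\<^sup>*\<close>, with \<open>T\<close> in place of \<open>T\<^sup>*\<close>.
\<close>

definition contraction :: real where
  "contraction = \<alpha> * B * drift_bound powr \<beta>"

lemma contraction_nonneg: "0 \<le> contraction"
  using \<alpha> B by (simp add: contraction_def)

lemma prob_barrier_window:
  assumes t: "0 < t" "t \<le> T" and "0 \<le> c"
  defines "m \<equiv> \<lambda>\<omega>. SUP s\<in>{0..<t}. \<alpha> * L s - W s \<omega>"
  shows "{\<omega> \<in> space M. m \<omega> - c \<le> Y0 \<omega> \<and> Y0 \<omega> \<le> m \<omega>} \<in> sets M"
    and "prob {\<omega> \<in> space M. m \<omega> - c \<le> Y0 \<omega> \<and> Y0 \<omega> \<le> m \<omega>} \<le> c * B * drift_bound powr \<beta>"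
    and "\<And>\<omega>. \<omega> \<in> space M \<Longrightarrow> bdd_above ((\<lambda>s. \<alpha> * L s - W s \<omega>) ` {0..<t})"
proof -
  define S where "S \<omega> = (SUP s\<in>{0..T}. W 0 \<omega> - W s \<omega>)" for \<omega>
  have S_upper: "W 0 \<omega> - W s \<omega> \<le> S \<omega>" if "\<omega> \<in> space M" "0 \<le> s" "s \<le> T" for \<omega> s
    unfolding S_def using that by (intro cSUP_upper brownian_paths_bounded[OF bm]) auto
  have S_nonneg: "0 \<le> S \<omega>" if "\<omega> \<in> space M" for \<omega>
    using S_upper[OF that, of 0] T by simp
  have S[measurable]: "S \<in> borel_measurable M"
    unfolding S_def by (rule brownian_max_measurable[OF fps bm T])
  have barrier: "\<alpha> * L s - W s \<omega> \<le> \<alpha> * Bt * T powr \<gamma> + S \<omega> - W 0 \<omega>"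
    if "\<omega> \<in> space M" "s \<in> {0..<t}" for \<omega> s
  proof -
    have "L s \<le> Bt * T powr \<gamma>"
      using L_mono[of s T] L_le[of T] that t T by auto
    then have "\<alpha> * L s \<le> \<alpha> * (Bt * T powr \<gamma>)" using \<alpha> by (intro mult_left_mono) auto
    then show ?thesis using S_upper[of \<omega> s] that t by auto
  qed
  then show bdd: "bdd_above ((\<lambda>s. \<alpha> * L s - W s \<omega>) ` {0..<t})" if "\<omega> \<in> space M" for \<omega>
    using that by (intro bdd_aboveI2) blast
  have Y0_meas[measurable]: "Y0 \<in> borel_measurable M" using distributed_measurable[OF Y0] by simp
  have "indep_var borel Y0 borel m"
    unfolding m_def
  proof (rule indep_var_path_functional[OF fps bm Y0_meas ind])
    show "continuous_on {0..<t} (\<lambda>s. \<alpha> * L s)"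
      using t by (intro continuous_intros continuous_on_subset[OF L_continuous]) auto
  qed (use t bdd in auto)
  then have [measurable]: "m \<in> borel_measurable M"
    and indep: "indep_var borel Y0 borel m" by (auto dest: indep_var_rv2)
  show "{\<omega> \<in> space M. m \<omega> - c \<le> Y0 \<omega> \<and> Y0 \<omega> \<le> m \<omega>} \<in> sets M"
    by measurable
  show "prob {\<omega> \<in> space M. m \<omega> - c \<le> Y0 \<omega> \<and> Y0 \<omega> \<le> m \<omega>} \<le> c * B * drift_bound powr \<beta>"
  proof (rule prob_near_barrier[OF Y0 f0 f indep B \<beta> \<open>0 \<le> c\<close> drift_bound_pos])
    show "(\<lambda>\<omega>. \<alpha> * Bt * T powr \<gamma> + S \<omega>) \<in> borel_measurable M" by measurable
    show "0 \<le> \<alpha> * Bt * T powr \<gamma> + S \<omega>" if "\<omega> \<in> space M" for \<omega>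
      using S_nonneg[OF that] \<alpha> Bt by simp
    have "AE \<omega> in M. W 0 \<omega> = 0" using bm by (simp add: standard_brownian_motion_def)
    then show "AE \<omega> in M. m \<omega> \<le> \<alpha> * Bt * T powr \<gamma> + S \<omega>"
      using AE_space
    proof eventually_elim
      case (elim \<omega>)
      then show ?case unfolding m_def using barrier[of \<omega>] t by (intro cSUP_least) auto
    qed
    have "(\<integral>\<^sup>+\<omega>. ennreal (\<alpha> * Bt * T powr \<gamma> + S \<omega>) \<partial>M)
        = (\<integral>\<^sup>+\<omega>. ennreal (\<alpha> * Bt * T powr \<gamma>) + ennreal (S \<omega>) \<partial>M)"
      using S_nonneg \<alpha> Bt by (intro nn_integral_cong ennreal_plus) auto
    also have "\<dots> = ennreal (\<alpha> * Bt * T powr \<gamma>) + (\<integral>\<^sup>+\<omega>. ennreal (S \<omega>) \<partial>M)"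
      by (subst nn_integral_add) (auto simp: emeasure_space_1)
    also have "\<dots> \<le> ennreal (\<alpha> * Bt * T powr \<gamma>) + ennreal (sqrt (2 * T / pi))"
      unfolding S_def by (intro add_left_mono brownian_expected_max[OF fps bm T])
    also have "\<dots> = ennreal drift_bound"
      using \<alpha> Bt T by (simp add: drift_bound_def ennreal_plus[symmetric] add.commute del: ennreal_plus)
    finally show "(\<integral>\<^sup>+\<omega>. ennreal (\<alpha> * Bt * T powr \<gamma> + S \<omega>) \<partial>M) \<le> ennreal drift_bound" .
  qed
qed

text \<open>
  The initial value of a path that hits 0 under the solution but survives under the scheme lies
  below the barrier \<open>m\<close> of the solution and above that of the scheme, and the two barriers differ
  by at most \<open>\<alpha> E\<close>.  So the excess of the loss function is at most the probability of the window
  \<open>[m - \<alpha> E, m]\<close>.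
\<close>

lemma bridge_scheme_step_error:
  assumes "0 < n" and scheme: "bridge_scheme M \<alpha> Y0 W T n Lb" and "0 < i" "i \<le> n" and "0 \<le> E"
    and lower: "\<And>s. 0 \<le> s \<Longrightarrow> s < mesh T n i \<Longrightarrow> Lb s \<le> L s"
    and upper: "\<And>s. 0 \<le> s \<Longrightarrow> s < mesh T n i \<Longrightarrow> L s \<le> Lb s + E"
  shows "Lb (mesh T n i) \<le> L (mesh T n i)"
    and "L (mesh T n i) \<le> Lb (mesh T n i) + contraction * E"
proof -
  define t where "t = mesh T n i"
  have t: "0 < t" "t \<le> T"
    using mesh_less[OF T \<open>0 < n\<close> \<open>0 < i\<close>] mesh_mono[OF T \<open>i \<le> n\<close>, of n] mesh_last[OF \<open>0 < n\<close>, of T]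
    by (auto simp: t_def mesh_def)
  define A where "A = {\<omega> \<in> space M. hitting_time {0..T} (mv_path \<alpha> Y0 W Lb \<omega>) < ereal t}"
  have Y0_meas: "Y0 \<in> borel_measurable M" using distributed_measurable[OF Y0] by simp
  have A: "A \<in> sets M"
    unfolding A_def t_def
    by (rule bridge_scheme_event_sets[OF fps bm Y0_meas \<open>0 < n\<close> T scheme \<open>i \<le> n\<close>])
  have Lb: "Lb t = prob A"
    unfolding A_def t_def by (rule bridge_scheme_mesh[OF \<open>0 < n\<close> T scheme \<open>i \<le> n\<close>])
  have "A \<subseteq> hit_before t"
  proof
    fix \<omega> assume "\<omega> \<in> A"
    then obtain s where s: "\<omega> \<in> space M" "0 \<le> s" "s \<le> T" "s < t" "mv_path \<alpha> Y0 W Lb \<omega> s \<le> 0"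
      by (auto simp: A_def hitting_time_less_iff)
    moreover have "\<alpha> * Lb s \<le> \<alpha> * L s"
      using lower[of s] s \<alpha> by (intro mult_left_mono) (auto simp: t_def)
    ultimately have "mv_path \<alpha> Y0 W L \<omega> s \<le> 0" unfolding mv_path_def by linarith
    then show "\<omega> \<in> hit_before t"
      using s J by (auto simp: hit_before_def hitting_time_less_iff)
  qed
  then show "Lb (mesh T n i) \<le> L (mesh T n i)"
    using finite_measure_mono[OF _ hit_before_sets[OF t]] prob_hit_before[OF t] Lb
    by (simp add: t_def)
  define m where "m \<omega> = (SUP s\<in>{0..<t}. \<alpha> * L s - W s \<omega>)" for \<omega>
  define R where "R = {\<omega> \<in> space M. m \<omega> - \<alpha> * E \<le> Y0 \<omega> \<and> Y0 \<omega> \<le> m \<omega>}"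
  have "0 \<le> \<alpha> * E" using \<alpha> \<open>0 \<le> E\<close> by simp
  note window = prob_barrier_window[OF t this, folded m_def, folded R_def]
  have "hit_before t \<subseteq> A \<union> R"
  proof
    fix \<omega> assume "\<omega> \<in> hit_before t"
    then obtain s where s: "\<omega> \<in> space M" "0 \<le> s" "s < t" "mv_path \<alpha> Y0 W L \<omega> s \<le> 0"
      using J by (auto simp: hit_before_def hitting_time_less_iff)
    have "Y0 \<omega> \<le> \<alpha> * L s - W s \<omega>" using s by (simp add: mv_path_def)
    also have "\<dots> \<le> m \<omega>"
      unfolding m_def using s by (intro cSUP_upper window(3)) auto
    finally have Y0_le: "Y0 \<omega> \<le> m \<omega>" .
    show "\<omega> \<in> A \<union> R"
    proof (cases "\<omega> \<in> A")
      case False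
      have "m \<omega> \<le> Y0 \<omega> + \<alpha> * E"
        unfolding m_def
      proof (rule cSUP_least)
        fix r assume r: "r \<in> {0..<t}"
        have "\<not> (\<exists>s\<in>{0..T}. s < t \<and> mv_path \<alpha> Y0 W Lb \<omega> s \<le> 0)"
          using False s(1) by (simp add: A_def hitting_time_less_iff)
        then have "0 < mv_path \<alpha> Y0 W Lb \<omega> r"
          using r t by force
        moreover have "\<alpha> * L r \<le> \<alpha> * (Lb r + E)"
          using upper[of r] r \<alpha> by (intro mult_left_mono) (auto simp: t_def)
        ultimately show "\<alpha> * L r - W r \<omega> \<le> Y0 \<omega> + \<alpha> * E"
          by (simp add: mv_path_def algebra_simps)
      qed (use t in auto)
      then show ?thesis using Y0_le s by (simp add: R_def)
    qed simp
  qed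
  then have "prob (hit_before t) \<le> prob (A \<union> R)"
    using A window(1) by (intro finite_measure_mono) auto
  also have "\<dots> \<le> prob A + prob R"
    using A window(1) by (rule measure_Un_le)
  also have "prob R \<le> contraction * E"
    using window(2) by (simp add: contraction_def mult_ac)
  finally show "L (mesh T n i) \<le> Lb (mesh T n i) + contraction * E"
    using prob_hit_before[OF t] Lb by (simp add: t_def)
qed

text \<open>
  With \<open>q\<close> the contraction factor and \<open>w\<close> a bound for the increase of \<open>L\<close> over a cell, an error of at
  most \<open>e\<close> at the earlier mesh points is an error of at most \<open>e + w\<close> in between, since the scheme is
  constant on each cell, and hence of at most \<open>q (e + w)\<close> at the next mesh point.  The fixed point
  of \<open>e \<mapsto> q (e + w)\<close> is \<open>q w / (1 - q)\<close>.
\<close>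

lemma bridge_scheme_error:
  assumes "contraction < 1" and "0 < n" and scheme: "bridge_scheme M \<alpha> Y0 W T n Lb" and "i \<le> n"
  shows "Lb (mesh T n i) \<le> L (mesh T n i) \<and>
    L (mesh T n i) \<le> Lb (mesh T n i) + contraction / (1 - contraction) * (K * (T / real n) powr \<gamma>)"
  using \<open>i \<le> n\<close>
proof (induction i rule: less_induct)
  case (less i)
  define w where "w = K * (T / real n) powr \<gamma>"
  have w: "0 \<le> w" using K by (simp add: w_def)
  define q where "q = contraction"
  have q: "0 \<le> q" "q < 1" using contraction_nonneg assms(1) by (auto simp: q_def)
  show ?case
  proof (cases "i = 0")
    case True
    have "Lb (mesh T n 0) = 0"
      using bridge_scheme_mesh[OF \<open>0 < n\<close> T scheme, of 0]
      by (simp add: hitting_time_less_iff mesh_def)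
    then show ?thesis
      using True L_0 w q unfolding w_def[symmetric] q_def[symmetric] by (simp add: mesh_def)
  next
    case False
    have prev: "Lb s \<le> L s \<and> L s \<le> Lb s + w / (1 - q)" if s: "0 \<le> s" "s < mesh T n i" for s
    proof -
      obtain j where j: "j < i" "s \<in> {mesh T n j..<mesh T n (Suc j)}"
        using mesh_interval[OF T s] by blast
      have j0: "0 \<le> mesh T n j" using T by (simp add: mesh_def)
      have "mesh T n (Suc j) \<le> T"
        using mesh_mono[OF T, of "Suc j" n n] j less.prems mesh_last[OF \<open>0 < n\<close>, of T] by simp
      then have sT: "mesh T n j \<le> s" "s \<le> T" using j by auto
      have eq: "Lb s = Lb (mesh T n j)"
        using bridge_scheme_step[OF \<open>0 < n\<close> T scheme _ j(2)] j less.prems by simp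
      have IH: "Lb (mesh T n j) \<le> L (mesh T n j)" "L (mesh T n j) \<le> Lb (mesh T n j) + q / (1 - q) * w"
        using less.IH[OF j(1)] j less.prems by (simp_all add: q_def w_def)
      have "L s - L (mesh T n j) \<le> K * (s - mesh T n j) powr \<gamma>"
        using L_Hoelder[OF j0 sT] .
      also have "\<dots> \<le> w"
      proof -
        have "s - mesh T n j \<le> T / real n"
          using j by (simp add: mesh_def distrib_right add_divide_distrib)
        then show ?thesis
          unfolding w_def using K \<gamma> sT by (intro mult_left_mono powr_mono2) auto
      qed
      finally have "L s \<le> Lb s + (q / (1 - q) * w + w)" using IH(2) eq by simp
      also have "q / (1 - q) * w + w = w / (1 - q)" using q by (simp add: field_simps)
      finally show ?thesis using IH(1) L_mono[OF j0 sT] eq by simp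
    qed
    have "0 \<le> w / (1 - q)" using w q by simp
    then have "Lb (mesh T n i) \<le> L (mesh T n i)" "L (mesh T n i) \<le> Lb (mesh T n i) + q * (w / (1 - q))"
      using bridge_scheme_step_error[OF \<open>0 < n\<close> scheme _ less.prems, of "w / (1 - q)"] prev False
      by (simp_all add: q_def)
    then show ?thesis by (simp add: q_def w_def)
  qed
qed

end

theorem theorem3:
  fixes M :: "'a measure" and F :: "real \<Rightarrow> 'a measure"
    and W :: "real \<Rightarrow> 'a \<Rightarrow> real" and Y0 :: "'a \<Rightarrow> real"
    and f :: "real \<Rightarrow> real" and L :: "real \<Rightarrow> real"
    and \<alpha> \<beta> T B Bt Tstar :: real
  assumes "filtered_prob_space M F"
    and "standard_brownian_motion M F W"
    and "0 < \<alpha>" and "0 < T" and "0 < \<beta>" and "\<beta> \<le> 1"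
    \<comment> \<open>initial condition\<close>
    and "\<forall>\<omega>\<in>space M. 0 \<le> Y0 \<omega>"
    and "indep_of_process M Y0 W"
    and "\<forall>x. 0 \<le> f x" and "\<forall>x<0. f x = 0"
    and "distributed M lborel Y0 f"
    \<comment> \<open>\<open>L\<close> is the differentiable solution up to the explosion time, with the known regularity\<close>
    and "mckean_vlasov_solution M \<alpha> Y0 W {t. 0 \<le> t \<and> ereal t < explosion_time L} L"
    and "\<exists>L' Bhat. weak_derivative {t. 0 < t \<and> ereal t < explosion_time L} L L' \<and>
           (AE t in lborel. 0 < t \<and> ereal t < explosion_time L \<longrightarrow>
              L' t \<le> Bhat * t powr (- ((1 - \<beta>) / 2)))"
    \<comment> \<open>smallest constants and the definition of \<open>Tstar\<close>\<close>
    and "is_arg_min (\<lambda>b. b) (\<lambda>b. \<forall>x\<ge>0. f x \<le> b * x powr \<beta>) B"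
    and "is_arg_min (\<lambda>b. b)
           (\<lambda>b. \<forall>t\<ge>0. ereal t < explosion_time L \<longrightarrow> L t \<le> b * t powr ((1 + \<beta>) / 2)) Bt"
    and "0 < Tstar"
    and "\<alpha> * B * (sqrt (2 * Tstar / pi) + \<alpha> * Bt * Tstar powr ((1 + \<beta>) / 2)) powr \<beta> = 1"
    and "ereal T < min (ereal Tstar) (explosion_time L)"
  shows "\<exists>C>0. \<forall>n\<ge>1. \<forall>Lb. bridge_scheme M \<alpha> Y0 W T n Lb \<longrightarrow>
           (MAX i\<in>{..n}. \<bar>Lb (mesh T n i) - L (mesh T n i)\<bar>) \<le> C * (T / real n) powr ((1 + \<beta>) / 2)"
proof -
  define e where "e = explosion_time L"
  define J where "J = {t. 0 \<le> t \<and> ereal t < e}"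
  define \<gamma> where "\<gamma> = (1 + \<beta>) / 2"
  have \<gamma>: "0 < \<gamma>" using assms by (simp add: \<gamma>_def)
  have M: "prob_space M" using assms(1) by (simp add: filtered_prob_space_def)
  have time: "0 < T" "T < Tstar" "ereal T < e" using assms by (auto simp: e_def)
  have sol: "mckean_vlasov_solution M \<alpha> Y0 W J L" using assms by (simp add: J_def e_def)
  have mono: "L s \<le> L t" if "0 \<le> s" "s \<le> t" "ereal t < e" for s t
    using that by (intro mckean_vlasov_loss_mono[OF M sol])
      (auto simp: J_def intro: le_less_trans[of _ "ereal t"])
  have L_nonneg: "0 \<le> L t" if "0 \<le> t" "ereal t < e" for t
    using sol that unfolding mckean_vlasov_solution_def J_def by auto
  have f: "f x \<le> B * x powr \<beta>" if "0 \<le> x" for x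
    using assms(14) that by (simp add: is_arg_min_def)
  have L_le: "L t \<le> Bt * t powr \<gamma>" if "0 \<le> t" "ereal t < e" for t
    using assms(15) that by (simp add: is_arg_min_def e_def \<gamma>_def)
  have "0 \<le> Bt"
  proof -
    have "0 \<le> Bt * T powr \<gamma>" using L_nonneg[of T] L_le[of T] time by simp
    then show ?thesis using time by (simp add: zero_le_mult_iff)
  qed
  \<comment> \<open>\<open>T\<^sup>*\<close> could not be defined by its equation otherwise\<close>
  have "0 < B"
  proof -
    have "0 \<le> B" using f[of 1] assms(9) order_trans[of 0 "f 1" B] by simp
    moreover have "B \<noteq> 0" using assms(17) by auto
    ultimately show ?thesis by simp
  qed
  obtain L' Bhat where L': "weak_derivative {t. 0 < t \<and> ereal t < e} L L'"
    "AE t in lborel. 0 < t \<and> ereal t < e \<longrightarrow> L' t \<le> Bhat * t powr (- ((1 - \<beta>) / 2))"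
    using assms(13) unfolding e_def by blast
  define K where "K = max 0 Bhat * 2 powr ((1 - \<beta>) / 2) + 2 * Bt"
  have K: "0 \<le> K" using \<open>0 \<le> Bt\<close> by (simp add: K_def)
  have Hoelder: "L t - L s \<le> K * (t - s) powr \<gamma>" if "0 \<le> s" "s \<le> t" "t \<le> T" for s t
    unfolding K_def \<gamma>_def
    by (rule loss_Hoelder[OF mono L_nonneg L_le[unfolded \<gamma>_def] assms(5,6) \<open>0 \<le> Bt\<close> L'])
      (use that time in \<open>auto intro: le_less_trans[of _ "ereal T"]\<close>)
  interpret mv_problem M F W Y0 f L J \<alpha> \<beta> \<gamma> T B Bt K
  proof
    show "J \<subseteq> {0..}" "{0..T} \<subseteq> J"
      using time by (auto simp: J_def intro: le_less_trans[of _ "ereal T"])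
    show "L t \<le> Bt * t powr \<gamma>" if "0 \<le> t" "t \<le> T" for t
      using that time by (intro L_le) (auto intro: le_less_trans[of _ "ereal T"])
  qed (use assms \<gamma> time sol f \<open>0 \<le> Bt\<close> \<open>0 < B\<close> K Hoelder in auto)
  have contraction: "contraction < 1"
  proof -
    have "drift_bound < sqrt (2 * Tstar / pi) + \<alpha> * Bt * Tstar powr \<gamma>"
      unfolding drift_bound_def using time assms(3) \<gamma> \<open>0 \<le> Bt\<close>
      by (intro add_less_le_mono mult_left_mono powr_mono2 real_sqrt_less_mono divide_strict_right_mono) auto
    then have "drift_bound powr \<beta> < (sqrt (2 * Tstar / pi) + \<alpha> * Bt * Tstar powr \<gamma>) powr \<beta>"
      using drift_bound_pos assms(5) by (intro powr_less_mono2) auto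
    then have "contraction < \<alpha> * B * (sqrt (2 * Tstar / pi) + \<alpha> * Bt * Tstar powr \<gamma>) powr \<beta>"
      unfolding contraction_def using assms(3) \<open>0 < B\<close> by (intro mult_strict_left_mono) auto
    then show ?thesis using assms(17) by (simp add: \<gamma>_def)
  qed
  define C where "C = contraction / (1 - contraction) * K + 1"
  have "0 < C" using contraction contraction_nonneg K by (auto simp: C_def intro!: add_nonneg_pos)
  show ?thesis
  proof (intro exI[of _ C] conjI allI impI \<open>0 < C\<close>)
    fix n :: nat and Lb assume n: "1 \<le> n" and scheme: "bridge_scheme M \<alpha> Y0 W T n Lb"
    have "\<bar>Lb (mesh T n i) - L (mesh T n i)\<bar> \<le> C * (T / real n) powr \<gamma>" if "i \<le> n" for i
    proof -
      have "\<bar>Lb (mesh T n i) - L (mesh T n i)\<bar>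
          \<le> contraction / (1 - contraction) * (K * (T / real n) powr \<gamma>)"
        using bridge_scheme_error[OF contraction _ scheme that] n by auto
      also have "\<dots> \<le> C * (T / real n) powr \<gamma>"
        by (simp add: C_def distrib_right mult.assoc)
      finally show ?thesis .
    qed
    then show "(MAX i\<in>{..n}. \<bar>Lb (mesh T n i) - L (mesh T n i)\<bar>) \<le> C * (T / real n) powr ((1 + \<beta>) / 2)"
      by (subst Max_le_iff) (auto simp: \<gamma>_def)
  qed
qed

end
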